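(* Suppose that $\mu_x$ is not a point mass, that the support of the continuous part of $\mu_x$ is contained in $\mathcal D$, and that there are no atoms of $\mu_x$ on $\mathrm{bd}(\mathcal D)=\mathrm{cl}(\mathcal D)\setminus\mathcal D$. Then the extended function $h:\mathbb C\to\mathbb C$ is a homeomorphism of $\mathbb C$.
   Context: $(\mathcal A,\varphi)$ is a $W^*$-probability space where $\varphi$ is a faithful trace. $x,y\in\mathcal A$ are selfadjoint and freely independent, and $y$ has free Poisson distribution with parameter $p\in(0,\infty)$ (all free cumulants of $y$ equal $p$). $\mu_x$ is the distribution of $x$ with respect to $\varphi$, a compactly supported probability measure on $\mathbb R$. The continuous part of $\mu_x$ means its non-atomic part. Let $E:M_2(\mathcal A)\to M_2(\mathbb C)$ apply $\varphi$ entrywise, $X=\begin{bmatrix}0 & x \\ x & 0\end{bmatrix}$, $J=\begin{bmatrix}0&\mathrm i\\-\mathrm i&0\end{bmatrix}$, and $\mathbb H_2^+=\{B\in M_2(\mathbb C):\Im B=\frac1{2\mathrm i}(B-B^* )\text{ is positive definite and invertible}\}$. Put $G_X(B)=E((B-X)^{-1})$ and $H(B)=B+p\,(J-G_X(B))^{-1}$ for $B\in\mathbb H_2^+$. For $\lambda\in\mathbb C$, $\zeta\in\mathbb C^+$ let $B(\lambda,\zeta)=\begin{bmatrix}\zeta&\lambda\\ \bar\lambda&\zeta\end{bmatrix}$, and let $H_{ij}(\lambda,\zeta)$ be the $(i,j)$-entry of $H(B(\lambda,\zeta))$. For every $\lambda$ the map $\delta\mapsto\Im H_{11}(\lambda,\mathrm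 i\delta)/\delta$ is continuous and strictly increasing on $(0,\infty)$ with limit $1$ at $\infty$. Set $\mathcal D=\{\lambda\in\mathbb C:\lim_{\delta\to0^+}\Im H_{11}(\lambda,\mathrm i\delta)/\delta<0\}$, an open set. For $\lambda\in\mathcal D$ let $\delta_0(\lambda)\in(0,\infty)$ be the unique number with $H_{11}(\lambda,\mathrm i\delta_0(\lambda))=0$, and put $h(\lambda)=H_{12}(\lambda,\mathrm i\delta_0(\lambda))$. Extension of $h$ to $\mathbb C$ (under the assumptions on $\mu_x$ in the claim): for $\lambda\in\mathbb C\setminus\mathcal D$ which is not an atom of $\mu_x$, $h(\lambda)=\lambda-\frac{p}{\mathrm i+G_{\mu_x}(\lambda)}$ with $G_{\mu_x}(\lambda)=\int_{\mathbb R}\frac{1}{\lambda-u}\,d\mu_x(u)$. There are finitely many atoms $\alpha_1,\dots,\alpha_k$ of $\mu_x$ outside $\mathrm{cl}(\mathcal D)$; they are removable singularities of this formula, and one puts $h(\alpha_i)=\alpha_i$. *)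

theory Defs
  imports "HOL-Analysis.Analysis" "HOL-Probability.Probability"
begin

section \<open>Tracial \<open>W\<^sup>*\<close>-probability spaces\<close>

class cstar_algebra = real_normed_algebra_1 + banach +
  fixes scaleC :: "complex \<Rightarrow> 'a \<Rightarrow> 'a"  (infixr "*\<^sub>C" 75)
    and adj :: "'a \<Rightarrow> 'a"
  assumes scaleC_add_right: "c *\<^sub>C (a + b) = c *\<^sub>C a + c *\<^sub>C b"
    and scaleC_add_left: "(c + d) *\<^sub>C a = c *\<^sub>C a + d *\<^sub>C a"
    and scaleC_scaleC: "c *\<^sub>C (d *\<^sub>C a) = (c * d) *\<^sub>C a"
    and scaleR_conv_scaleC: "r *\<^sub>R a = complex_of_real r *\<^sub>C a"
    and mult_scaleC_left: "(c *\<^sub>C a) * b = c *\<^sub>C (a * b)"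
    and mult_scaleC_right: "a * (c *\<^sub>C b) = c *\<^sub>C (a * b)"
    and norm_scaleC: "norm (c *\<^sub>C a) = cmod c * norm a"
    and adj_adj: "adj (adj a) = a"
    and adj_add: "adj (a + b) = adj a + adj b"
    and adj_scaleC: "adj (c *\<^sub>C a) = cnj c *\<^sub>C adj a"
    and adj_mult: "adj (a * b) = adj b * adj a"
    and cstar_identity: "norm (adj a * a) = (norm a)\<^sup>2"

definition cscale_functional :: "complex \<Rightarrow> ('a::real_normed_vector \<Rightarrow>\<^sub>L complex) \<Rightarrow> 'a \<Rightarrow>\<^sub>L complex" where
  "cscale_functional c f = blinfun_compose (blinfun_mult_right c) f"

text \<open>A \<open>W\<^sup>*\<close>-algebra is taken in Sakai's sense: a \<open>C\<^sup>*\<close>-algebra that is the dual of a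
  Banach space. A predual is represented by its image in the dual of the algebra, that is, by a
  norm-closed complex subspace \<open>P\<close> of bounded complex-linear functionals such that evaluation is
  an isometric isomorphism from the algebra onto the dual of \<open>P\<close>. The predual is unique; its
  elements are the normal functionals.\<close>

definition predual :: "('a::cstar_algebra \<Rightarrow>\<^sub>L complex) set \<Rightarrow> bool" where
  "predual P \<longleftrightarrow>
     (\<forall>f\<in>P. \<forall>c a. blinfun_apply f (c *\<^sub>C a) = c * blinfun_apply f a) \<and>
     subspace P \<and> (\<forall>c. \<forall>f\<in>P. cscale_functional c f \<in> P) \<and> closed P \<and>
     (\<forall>a. norm a = (SUP f\<in>{f\<in>P. norm f \<le> 1}. cmod (blinfun_apply f a))) \<and>
     (\<forall>F :: ('a \<Rightarrow>\<^sub>L complex) \<Rightarrow> complex.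
        (\<forall>f\<in>P. \<forall>g\<in>P. F (f + g) = F f + F g) \<and>
        (\<forall>c. \<forall>f\<in>P. F (cscale_functional c f) = c * F f) \<and>
        (\<exists>K. \<forall>f\<in>P. cmod (F f) \<le> K * norm f)
        \<longrightarrow> (\<exists>a. \<forall>f\<in>P. F f = blinfun_apply f a))"

definition wstar_probability_space :: "('a::cstar_algebra \<Rightarrow> complex) \<Rightarrow> bool" where
  "wstar_probability_space \<phi> \<longleftrightarrow>
     (\<exists>P. predual P \<and> \<phi> \<in> blinfun_apply ` P) \<and>
     \<phi> 1 = 1 \<and> (\<forall>a. \<phi> (adj a * a) \<in> \<real>\<^sub>\<ge>\<^sub>0)"

definition faithful_state :: "('a::cstar_algebra \<Rightarrow> complex) \<Rightarrow> bool" where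
  "faithful_state \<phi> \<longleftrightarrow> (\<forall>a. \<phi> (adj a * a) = 0 \<longrightarrow> a = 0)"

definition tracial :: "('a::cstar_algebra \<Rightarrow> complex) \<Rightarrow> bool" where
  "tracial \<phi> \<longleftrightarrow> (\<forall>a b. \<phi> (a * b) = \<phi> (b * a))"

definition selfadjoint :: "'a::cstar_algebra \<Rightarrow> bool" where
  "selfadjoint a \<longleftrightarrow> adj a = a"


section \<open>Free independence, free cumulants, distributions\<close>

inductive_set star_subalgebra_generated :: "'a::cstar_algebra set \<Rightarrow> 'a set" for S where
  generator: "a \<in> S \<Longrightarrow> a \<in> star_subalgebra_generated S"
| one: "1 \<in> star_subalgebra_generated S"
| add: "a \<in> star_subalgebra_generated S \<Longrightarrow> b \<in> star_subalgebra_generated S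
        \<Longrightarrow> a + b \<in> star_subalgebra_generated S"
| mult: "a \<in> star_subalgebra_generated S \<Longrightarrow> b \<in> star_subalgebra_generated S
        \<Longrightarrow> a * b \<in> star_subalgebra_generated S"
| scaleC: "a \<in> star_subalgebra_generated S \<Longrightarrow> c *\<^sub>C a \<in> star_subalgebra_generated S"
| adj: "a \<in> star_subalgebra_generated S \<Longrightarrow> adj a \<in> star_subalgebra_generated S"

definition free_subalgebras :: "('a::cstar_algebra \<Rightarrow> complex) \<Rightarrow> ('i \<Rightarrow> 'a set) \<Rightarrow> bool" where
  "free_subalgebras \<phi> A \<longleftrightarrow>
     (\<forall>js as. length js = length as \<and> as \<noteq> [] \<and>
        (\<forall>k < length as. as ! k \<in> A (js ! k) \<and> \<phi> (as ! k) = 0) \<and>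
        (\<forall>k. Suc k < length as \<longrightarrow> js ! k \<noteq> js ! Suc k)
        \<longrightarrow> \<phi> (prod_list as) = 0)"

definition freely_independent :: "('a::cstar_algebra \<Rightarrow> complex) \<Rightarrow> 'a \<Rightarrow> 'a \<Rightarrow> bool" where
  "freely_independent \<phi> x y \<longleftrightarrow>
     free_subalgebras \<phi> (\<lambda>j::bool. star_subalgebra_generated {if j then y else x})"

definition noncrossing :: "nat set set \<Rightarrow> bool" where
  "noncrossing \<pi> \<longleftrightarrow>
     (\<forall>V\<in>\<pi>. \<forall>W\<in>\<pi>. V \<noteq> W \<longrightarrow>
        \<not> (\<exists>a b c d. a < b \<and> b < c \<and> c < d \<and> a \<in> V \<and> b \<in> W \<and> c \<in> V \<and> d \<in> W))"

definition noncrossing_partitions :: "nat \<Rightarrow> nat set set set" where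
  "noncrossing_partitions n = {\<pi>. partition_on {1..n} \<pi> \<and> noncrossing \<pi>}"

text \<open>The moment-cumulant formula; it determines \<open>\<kappa> n\<close> for every \<open>n \<ge> 1\<close>.\<close>

definition has_free_cumulants ::
    "('a::cstar_algebra \<Rightarrow> complex) \<Rightarrow> 'a \<Rightarrow> (nat \<Rightarrow> complex) \<Rightarrow> bool" where
  "has_free_cumulants \<phi> a \<kappa> \<longleftrightarrow>
     (\<forall>n\<ge>1. \<phi> (a ^ n) = (\<Sum>\<pi>\<in>noncrossing_partitions n. \<Prod>V\<in>\<pi>. \<kappa> (card V)))"

definition free_Poisson :: "('a::cstar_algebra \<Rightarrow> complex) \<Rightarrow> 'a \<Rightarrow> real \<Rightarrow> bool" where
  "free_Poisson \<phi> y p \<longleftrightarrow> has_free_cumulants \<phi> y (\<lambda>_. complex_of_real p)"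

text \<open>The distribution of a selfadjoint element: the compactly supported Borel probability
  measure with the same moments, which is unique.\<close>

definition is_distribution :: "('a::cstar_algebra \<Rightarrow> complex) \<Rightarrow> 'a \<Rightarrow> real measure \<Rightarrow> bool" where
  "is_distribution \<phi> a \<mu> \<longleftrightarrow>
     prob_space \<mu> \<and> sets \<mu> = sets borel \<and>
     (\<exists>K. compact K \<and> emeasure \<mu> (- K) = 0) \<and>
     (\<forall>n. \<phi> (a ^ n) = complex_of_real (\<integral>u. u ^ n \<partial>\<mu>))"

definition atoms :: "real measure \<Rightarrow> real set" where
  "atoms \<mu> = {u. measure \<mu> {u} > 0}"

definition point_mass :: "real measure \<Rightarrow> bool" where
  "point_mass \<mu> \<longleftrightarrow> (\<exists>u. measure \<mu> {u} = 1)"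

definition continuous_part :: "real measure \<Rightarrow> real measure" where
  "continuous_part \<mu> = density \<mu> (indicator (- atoms \<mu>))"

definition measure_support :: "real measure \<Rightarrow> real set" where
  "measure_support \<mu> = {u. \<forall>U. open U \<and> u \<in> U \<longrightarrow> emeasure \<mu> U > 0}"

definition Cauchy_transform :: "real measure \<Rightarrow> complex \<Rightarrow> complex" where
  "Cauchy_transform \<mu> z = (\<integral>u. 1 / (z - complex_of_real u) \<partial>\<mu>)"


section \<open>The map \<open>H\<close>, the set \<open>\<D>\<close> and the function \<open>h\<close>\<close>

definition mat2 :: "'a::zero \<Rightarrow> 'a \<Rightarrow> 'a \<Rightarrow> 'a \<Rightarrow> 'a^2^2" where
  "mat2 a b c d = vector [vector [a, b], vector [c, d]]"

text \<open>Complex matrices are regarded as elements of \<open>M\<^sub>2(\<A>)\<close> by sending an entry \<open>c\<close> to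
  \<open>c *\<^sub>C 1\<close>. Both inverses below exist whenever the imaginary part of \<open>B\<close> is positive definite,
  in particular at \<open>B = Bmat z \<zeta>\<close> with \<open>Im \<zeta> > 0\<close>.\<close>

definition G_X :: "('a::cstar_algebra \<Rightarrow> complex) \<Rightarrow> 'a \<Rightarrow> complex^2^2 \<Rightarrow> complex^2^2" where
  "G_X \<phi> x B =
     map_matrix \<phi> (matrix_inv (map_matrix (\<lambda>c. c *\<^sub>C 1) B - mat2 0 x x 0))"

definition H :: "('a::cstar_algebra \<Rightarrow> complex) \<Rightarrow> 'a \<Rightarrow> real \<Rightarrow> complex^2^2 \<Rightarrow> complex^2^2" where
  "H \<phi> x p B = B + p *\<^sub>R matrix_inv (mat2 0 \<i> (- \<i>) 0 - G_X \<phi> x B)"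

definition Bmat :: "complex \<Rightarrow> complex \<Rightarrow> complex^2^2" where
  "Bmat z \<zeta> = mat2 \<zeta> z (cnj z) \<zeta>"

definition H11 :: "('a::cstar_algebra \<Rightarrow> complex) \<Rightarrow> 'a \<Rightarrow> real \<Rightarrow> complex \<Rightarrow> complex \<Rightarrow> complex" where
  "H11 \<phi> x p z \<zeta> = H \<phi> x p (Bmat z \<zeta>) $ 1 $ 1"

definition H12 :: "('a::cstar_algebra \<Rightarrow> complex) \<Rightarrow> 'a \<Rightarrow> real \<Rightarrow> complex \<Rightarrow> complex \<Rightarrow> complex" where
  "H12 \<phi> x p z \<zeta> = H \<phi> x p (Bmat z \<zeta>) $ 1 $ 2"

text \<open>The limit defining \<open>\<D>\<close> is taken in the extended reals, since it may be \<open>-\<infinity>\<close>.\<close>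

definition domD :: "('a::cstar_algebra \<Rightarrow> complex) \<Rightarrow> 'a \<Rightarrow> real \<Rightarrow> complex set" where
  "domD \<phi> x p =
     {z. \<exists>l::ereal. l < 0 \<and>
        ((\<lambda>\<delta>. ereal (Im (H11 \<phi> x p z (\<i> * complex_of_real \<delta>)) / \<delta>)) \<longlongrightarrow> l) (at_right 0)}"

definition delta0 :: "('a::cstar_algebra \<Rightarrow> complex) \<Rightarrow> 'a \<Rightarrow> real \<Rightarrow> complex \<Rightarrow> real" where
  "delta0 \<phi> x p z = (THE \<delta>. 0 < \<delta> \<and> H11 \<phi> x p z (\<i> * complex_of_real \<delta>) = 0)"

text \<open>The middle case only concerns atoms outside the closure of \<open>\<D>\<close> when, as assumed where
  \<open>h\<close> is used, the boundary of \<open>\<D>\<close> carries no atoms.\<close>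

definition h :: "('a::cstar_algebra \<Rightarrow> complex) \<Rightarrow> 'a \<Rightarrow> real \<Rightarrow> real measure \<Rightarrow> complex \<Rightarrow> complex" where
  "h \<phi> x p \<mu> z =
     (if z \<in> domD \<phi> x p then H12 \<phi> x p z (\<i> * complex_of_real (delta0 \<phi> x p z))
      else if z \<in> complex_of_real ` atoms \<mu> then z
      else z - complex_of_real p / (\<i> + Cauchy_transform \<mu> z))"

end

theory Submission
  imports Defs
begin

text \<open>Identify the point \<open>q = (\<lambda>, \<delta>)\<close> of the closed upper half-space \<open>\<complex> \<times> [0, \<infinity>)\<close> with
  \<open>B(\<lambda>, \<i>\<delta>)\<close>. As the entries of \<open>B - X\<close> commute, \<open>G\<^sub>X\<close> is an integral against \<open>\<mu>\<close>, and in these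
  coordinates \<open>H\<close> becomes \<open>q \<mapsto> q - p \<iota>(\<integral>\<iota>(q - u) d\<mu>(u) - (\<i>, 0))\<close> with the inversion
  \<open>\<iota>(v) = v / \<bar>v\<bar>\<^sup>2\<close> of three-dimensional space. Since \<open>\<bar>\<iota>(v) - \<iota>(w)\<bar> = \<bar>v - w\<bar> / (\<bar>v\<bar> \<bar>w\<bar>)\<close>, the
  Cauchy-Schwarz inequality shows that the subtracted term is 1-Lipschitz on the set of points where
  the second coordinate of \<open>H\<close> is nonnegative, and that it preserves no distance between distinct
  points there, unless \<open>\<mu>\<close> is a point mass. The function \<open>h\<close> is the restriction of \<open>H\<close> to the graph
  of the continuous function equal to \<open>\<delta>\<^sub>0\<close> on \<open>\<D>\<close> and to \<open>0\<close> off \<open>\<D>\<close>, except at the atoms off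
  \<open>\<D>\<close>: these have mass at least \<open>p\<close>, and the same estimates hold there. So \<open>h\<close> is continuous and injective, and \<open>h(z) - z\<close> is
  bounded near \<open>\<infinity>\<close>; invariance of domain does the rest.\<close>

section \<open>The contraction estimate\<close>

text \<open>The inversion comes from matrices: for q = (z, d) the matrix
  \<open>Bmat z (\<i> * d)\<close> has determinant -|q|^2, so its inverse is the matrix attached to
  q / |q|^2 with the sign of the second coordinate reversed. The matrix J is attached to (\<i>, 0),
  and the sign reversals of the two inverses in H cancel. Let S(q) be the integral of 1 / |q - u|^2
  and W(q) the vector to which the outer inversion is applied. Cauchy-Schwarz bounds p |\<iota>(W q)
  - \<iota>(W q')| by p sqrt(S(q) S(q')) |q - q'| / (|W q| |W q'|), and nonnegativity of the second
  coordinate of H at positive height means p S \<le> |W|^2. If H took the same value at q and q',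
  the subtracted terms would differ by exactly q - q'. The obstacle is height 0, where the integrals
  may diverge. There p S \<le> |W|^2 is only the limit of inequalities at positive heights, and
  taking this limit requires S to stay bounded. To this end |W|^2 is bounded by S times a factor
  close to the mass of the atom, plus a constant; if the mass is below p, this can be solved for
  S.\<close>

definition inversion :: "'a::real_inner \<Rightarrow> 'a" where
  "inversion x = x /\<^sub>R (norm x)\<^sup>2"

lemma norm_inversion: "norm (inversion x) = 1 / norm x"
  by (cases "x = 0") (simp_all add: inversion_def power2_eq_square field_simps)

lemma norm_inversion_diff:
  fixes x y :: "'a::real_inner"
  assumes "x \<noteq> 0" "y \<noteq> 0"
  shows "norm (inversion x - inversion y) = norm (x - y) / (norm x * norm y)"
proof -
  let ?a = "x \<bullet> x" and ?b = "y \<bullet> y"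
  have pos: "?a > 0" "?b > 0"
    using assms by auto
  have "(norm (inversion x - inversion y))\<^sup>2 = (norm (x - y) / (norm x * norm y))\<^sup>2"
    unfolding power_divide power_mult_distrib power2_norm_eq_inner inversion_def
    using pos by (simp add: inner_diff_left inner_diff_right field_simps inner_commute)
  then show ?thesis
    by (simp add: power2_eq_iff_nonneg)
qed

abbreviation axis_point :: "real \<Rightarrow> complex \<times> real" where
  "axis_point u \<equiv> (complex_of_real u, 0)"

lemma norm_axis_diff: "(norm (q - axis_point u))\<^sup>2 = (cmod (fst q - of_real u))\<^sup>2 + (snd q)\<^sup>2"
  by (cases q) (simp add: norm_Pair)

lemma norm_axis_diff_Re_Im:
  "(norm (q - axis_point u))\<^sup>2 = (Re (fst q) - u)\<^sup>2 + ((Im (fst q))\<^sup>2 + (snd q)\<^sup>2)"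
  by (simp add: norm_axis_diff cmod_power2)

locale bounded_distribution = prob_space \<mu> for \<mu> :: "real measure" +
  fixes R :: real
  assumes sets_eq: "sets \<mu> = sets borel"
    and AE_bounded: "AE u in \<mu>. \<bar>u\<bar> \<le> R"
begin

text \<open>For \<open>q = (z, \<delta>)\<close> with \<open>\<delta> > 0\<close>, the first row of \<open>G\<^sub>X(B(z, \<i>\<delta>))\<close> is \<open>(-\<i>\<delta> S q, fst (V q))\<close>, and
  \<open>(norm (W q))\<^sup>2\<close> is minus the determinant of \<open>J - G\<^sub>X(B(z, \<i>\<delta>))\<close>.\<close>

definition S :: "complex \<times> real \<Rightarrow> real" where
  "S q = (\<integral>u. 1 / (norm (q - axis_point u))\<^sup>2 \<partial>\<mu>)"

definition V :: "complex \<times> real \<Rightarrow> complex \<times> real" where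
  "V q = (\<integral>u. inversion (q - axis_point u) \<partial>\<mu>)"

definition W :: "complex \<times> real \<Rightarrow> complex \<times> real" where
  "W q = V q - (\<i>, 0)"

text \<open>The second conjunct guards against 1 / 0 = 0: an atom of \<mu> at q would not affect the
  first one. At points that are not regular, \<open>S q\<close> and \<open>V q\<close> may be mere
  default values.\<close>

definition regular :: "complex \<times> real \<Rightarrow> bool" where
  "regular q \<longleftrightarrow> integrable \<mu> (\<lambda>u. 1 / (norm (q - axis_point u))\<^sup>2) \<and> (AE u in \<mu>. q \<noteq> axis_point u)"

lemma measurable_axis [measurable]: "axis_point \<in> borel_measurable \<mu>"
  unfolding measurable_cong_sets[OF sets_eq refl]
  by (intro borel_measurable_continuous_onI continuous_intros)

lemma measurable_axis_diff [measurable]: "(\<lambda>u. q - axis_point u) \<in> borel_measurable \<mu>"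
  by (intro borel_measurable_diff measurable_axis) simp

lemma measurable_inversion_diff [measurable]:
  "(\<lambda>u. inversion (q - axis_point u)) \<in> borel_measurable \<mu>"
  unfolding inversion_def by measurable

lemma integrable_inversion:
  assumes "regular q"
  shows "integrable \<mu> (\<lambda>u. inversion (q - axis_point u))"
proof (rule Bochner_Integration.integrable_bound)
  show "integrable \<mu> (\<lambda>u. 1 + 1 / (norm (q - axis_point u))\<^sup>2)"
    using assms by (auto simp: regular_def)
  have "t \<le> 1 + t\<^sup>2" for t :: real
    using zero_le_power2[of "t - 1/2"] by (simp add: power2_diff algebra_simps) (simp add: power2_eq_square)
  from this[of "1 / norm (q - axis_point u)" for u]
  show "AE u in \<mu>. norm (inversion (q - axis_point u)) \<le> norm (1 + 1 / (norm (q - axis_point u))\<^sup>2)"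
    by (simp add: norm_inversion power_divide)
qed measurable

lemma regular_snd:
  assumes "snd q \<noteq> 0"
  shows "regular q"
  unfolding regular_def
proof
  have "1 / (norm (q - axis_point u))\<^sup>2 \<le> 1 / (snd q)\<^sup>2" for u
  proof (rule divide_left_mono)
    show "(snd q)\<^sup>2 \<le> (norm (q - axis_point u))\<^sup>2"
      by (simp add: norm_axis_diff)
    then show "0 < (norm (q - axis_point u))\<^sup>2 * (snd q)\<^sup>2"
      using assms by (smt (verit) mult_pos_pos zero_less_power2)
  qed simp
  then show "integrable \<mu> (\<lambda>u. 1 / (norm (q - axis_point u))\<^sup>2)"
    by (intro integrable_const_bound[where B="1 / (snd q)\<^sup>2"]) auto
  show "AE u in \<mu>. q \<noteq> axis_point u"
    using assms by auto
qed

lemma S_nonneg: "S q \<ge> 0"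
  unfolding S_def by simp

lemma S_pos:
  assumes "regular q"
  shows "S q > 0"
proof -
  have "S q \<noteq> 0"
  proof
    assume "S q = 0"
    then have "AE u in \<mu>. 1 / (norm (q - axis_point u))\<^sup>2 = 0"
      using assms by (subst integral_nonneg_eq_0_iff_AE[symmetric]) (auto simp: S_def regular_def)
    moreover have "AE u in \<mu>. q \<noteq> axis_point u"
      using assms by (simp add: regular_def)
    ultimately have "AE u in \<mu>. False"
      by eventually_elim auto
    then show False
      by simp
  qed
  then show ?thesis
    using S_nonneg[of q] by linarith
qed

text \<open>The left side of the last assumption is the norm of the difference of two inversions.
  The majorant f is left open: the contraction uses a weighted sum, the continuity of
  \<open>V\<close> a constant.\<close>

lemma norm_V_diff_le_integral:
  assumes "regular q" "regular q'"
    and "integrable \<mu> f"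
    and "AE u in \<mu>. norm (q - q') / (norm (q - axis_point u) * norm (q' - axis_point u)) \<le> f u"
  shows "norm (V q - V q') \<le> (\<integral>u. f u \<partial>\<mu>)"
proof -
  have int: "integrable \<mu> (\<lambda>u. inversion (q - axis_point u) - inversion (q' - axis_point u))"
    using assms integrable_inversion by auto
  have "AE u in \<mu>. q \<noteq> axis_point u" "AE u in \<mu>. q' \<noteq> axis_point u"
    using assms by (auto simp: regular_def)
  with assms(4) have *: "AE u in \<mu>. norm (inversion (q - axis_point u) - inversion (q' - axis_point u)) \<le> f u"
    by eventually_elim (subst norm_inversion_diff, auto)
  have "V q - V q' = (\<integral>u. inversion (q - axis_point u) - inversion (q' - axis_point u) \<partial>\<mu>)"
    using assms integrable_inversion by (simp add: V_def)
  also have "norm \<dots> \<le> (\<integral>u. norm (inversion (q - axis_point u) - inversion (q' - axis_point u)) \<partial>\<mu>)"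
    by simp
  also have "\<dots> \<le> (\<integral>u. f u \<partial>\<mu>)"
    by (intro integral_mono_AE integrable_norm int assms(3) *)
  finally show ?thesis .
qed

text \<open>A pointwise form of Cauchy-Schwarz: the two sides differ by a multiple of (m r - n s)^2,
  which also settles equality. With these weights, the bounds p S(q) \<le> m^2 and p S(q') \<le> n^2
  make each term contribute at most m n after integration.\<close>

lemma two_divide_le:
  fixes m n r s :: real
  assumes "m > 0" "n > 0" "r > 0" "s > 0"
  shows "2 / (r * s) \<le> (n / m) / r\<^sup>2 + (m / n) / s\<^sup>2"
    and "2 / (r * s) = (n / m) / r\<^sup>2 + (m / n) / s\<^sup>2 \<Longrightarrow> m * r = n * s"
proof -
  have eq: "(n / m) / r\<^sup>2 + (m / n) / s\<^sup>2 - 2 / (r * s) = (m * r - n * s)\<^sup>2 / (m * n * r\<^sup>2 * s\<^sup>2)"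
    using assms by (simp add: field_simps power2_eq_square)
  show "2 / (r * s) \<le> (n / m) / r\<^sup>2 + (m / n) / s\<^sup>2"
    using assms eq by (smt (verit) zero_le_power2 divide_nonneg_nonneg mult_nonneg_nonneg)
  assume "2 / (r * s) = (n / m) / r\<^sup>2 + (m / n) / s\<^sup>2"
  with eq have "(m * r - n * s)\<^sup>2 / (m * n * r\<^sup>2 * s\<^sup>2) = 0"
    by linarith
  then show "m * r = n * s"
    using assms by auto
qed

lemma integrable_weighted:
  assumes "regular q" "regular q'"
  shows "integrable \<mu> (\<lambda>u. d / 2 * (a / (norm (q - axis_point u))\<^sup>2 + b / (norm (q' - axis_point u))\<^sup>2))"
    and "(\<integral>u. d / 2 * (a / (norm (q - axis_point u))\<^sup>2 + b / (norm (q' - axis_point u))\<^sup>2) \<partial>\<mu>)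
      = d / 2 * (a * S q + b * S q')"
proof -
  have *: "a / (norm (q - axis_point u))\<^sup>2 = a * (1 / (norm (q - axis_point u))\<^sup>2)" for a q u
    by simp
  have i: "integrable \<mu> (\<lambda>u. a / (norm (q - axis_point u))\<^sup>2)" if "regular q" for a q
    using that unfolding regular_def *[of a] by (intro integrable_mult_right) auto
  show "integrable \<mu> (\<lambda>u. d / 2 * (a / (norm (q - axis_point u))\<^sup>2 + b / (norm (q' - axis_point u))\<^sup>2))"
    using i assms by (intro integrable_mult_right Bochner_Integration.integrable_add) auto
  have e: "(\<integral>u. a / (norm (q - axis_point u))\<^sup>2 \<partial>\<mu>) = a * S q" for a q
    unfolding S_def *[of a] by (rule integral_mult_right_zero)
  show "(\<integral>u. d / 2 * (a / (norm (q - axis_point u))\<^sup>2 + b / (norm (q' - axis_point u))\<^sup>2) \<partial>\<mu>)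
      = d / 2 * (a * S q + b * S q')"
    using i assms by (subst integral_mult_right_zero, subst Bochner_Integration.integral_add) (auto simp: e)
qed

lemma weighted_bound:
  assumes "m > 0" "n > 0" "p > 0" "p * S q \<le> m\<^sup>2" "p * S q' \<le> n\<^sup>2" "d \<ge> 0"
  shows "p * (d / 2 * ((n / m) * S q + (m / n) * S q')) \<le> m * n * d"
proof -
  have "(n / m) * (p * S q) \<le> (n / m) * m\<^sup>2" "(m / n) * (p * S q') \<le> (m / n) * n\<^sup>2"
    using assms by (intro mult_left_mono; simp)+
  then have "(n / m) * (p * S q) + (m / n) * (p * S q') \<le> 2 * (m * n)"
    using assms by (simp add: power2_eq_square mult.commute)
  from mult_left_mono[OF this, of "d / 2"] assms(6) show ?thesis
    by (simp add: algebra_simps)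
qed

text \<open>Used with m = |W q| and n = |W q'|: division by m n then gives the 1-Lipschitz bound for
  \<open>p *\<^sub>R inversion (W q)\<close>.\<close>

lemma contraction:
  assumes "regular q" "regular q'"
    and "m > 0" "n > 0" "p > 0" "p * S q \<le> m\<^sup>2" "p * S q' \<le> n\<^sup>2"
  shows "p * norm (V q - V q') \<le> m * n * norm (q - q')"
proof -
  let ?d = "norm (q - q')"
  let ?f = "\<lambda>u. ?d / 2 * ((n / m) / (norm (q - axis_point u))\<^sup>2 + (m / n) / (norm (q' - axis_point u))\<^sup>2)"
  have "AE u in \<mu>. q \<noteq> axis_point u" "AE u in \<mu>. q' \<noteq> axis_point u"
    using assms by (auto simp: regular_def)
  then have "AE u in \<mu>. ?d / (norm (q - axis_point u) * norm (q' - axis_point u)) \<le> ?f u"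
  proof eventually_elim
    case (elim u)
    with assms have "2 / (norm (q - axis_point u) * norm (q' - axis_point u))
      \<le> (n / m) / (norm (q - axis_point u))\<^sup>2 + (m / n) / (norm (q' - axis_point u))\<^sup>2"
      by (intro two_divide_le) auto
    from mult_left_mono[OF this, of "?d / 2"] show ?case
      by simp
  qed
  then have "norm (V q - V q') \<le> integral\<^sup>L \<mu> ?f"
    using assms by (intro norm_V_diff_le_integral integrable_weighted) auto
  also have "\<dots> = ?d / 2 * ((n / m) * S q + (m / n) * S q')"
    using assms by (intro integrable_weighted)
  finally have "p * norm (V q - V q') \<le> p * (?d / 2 * ((n / m) * S q + (m / n) * S q'))"
    using assms by simp
  also have "\<dots> \<le> m * n * ?d"
    using assms by (intro weighted_bound) auto
  finally show ?thesis .
qed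

text \<open>The contraction chains three estimates: the norm of an integral, the pointwise
  inequality, and the bounds on S. If nothing is lost overall, the first leaves a common direction e
  = V q - V q' for almost all u, and the second leaves proportional distances.\<close>

lemma contraction_equality:
  assumes "regular q" "regular q'"
    and "m > 0" "n > 0" "p > 0" "p * S q \<le> m\<^sup>2" "p * S q' \<le> n\<^sup>2"
    and "q \<noteq> q'" and eq: "p * norm (V q - V q') = m * n * norm (q - q')"
  obtains e where "AE u in \<mu>. q \<noteq> axis_point u \<and> q' \<noteq> axis_point u \<and>
      m * norm (q - axis_point u) = n * norm (q' - axis_point u) \<and>
      (\<exists>t>0. inversion (q - axis_point u) - inversion (q' - axis_point u) = t *\<^sub>R e)"
proof
  let ?d = "norm (q - q')"
  define e where "e = V q - V q'"
  let ?i = "\<lambda>u. inversion (q - axis_point u) - inversion (q' - axis_point u)"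
  let ?f = "\<lambda>u. ?d / 2 * ((n / m) / (norm (q - axis_point u))\<^sup>2 + (m / n) / (norm (q' - axis_point u))\<^sup>2)"
  \<comment> \<open>This integrand records both pointwise losses at once. Projecting onto e is what
    makes it integrable in closed form, since \<open>?i u \<bullet> e\<close> has integral
    |e|^2.\<close>
  let ?g = "\<lambda>u. norm e * ?f u - ?i u \<bullet> e"
  have d: "?d > 0"
    using assms(8) by simp
  have e: "norm e > 0"
  proof -
    have "p * norm e > 0"
      using assms(3,4) d unfolding e_def eq by simp
    then show ?thesis
      using assms(5) by (simp add: zero_less_mult_iff)
  qed
  have ne: "AE u in \<mu>. q \<noteq> axis_point u" "AE u in \<mu>. q' \<noteq> axis_point u"
    using assms(1,2) by (auto simp: regular_def)
  have key: "?d / (norm (q - axis_point u) * norm (q' - axis_point u)) \<le> ?f u"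
      "norm (?i u) = ?d / (norm (q - axis_point u) * norm (q' - axis_point u))"
    if "q \<noteq> axis_point u" "q' \<noteq> axis_point u" for u
  proof -
    from that assms(3,4) have "2 / (norm (q - axis_point u) * norm (q' - axis_point u))
      \<le> (n / m) / (norm (q - axis_point u))\<^sup>2 + (m / n) / (norm (q' - axis_point u))\<^sup>2"
      by (intro two_divide_le) auto
    from mult_left_mono[OF this, of "?d / 2"]
    show "?d / (norm (q - axis_point u) * norm (q' - axis_point u)) \<le> ?f u"
      by simp
    show "norm (?i u) = ?d / (norm (q - axis_point u) * norm (q' - axis_point u))"
      using that by (subst norm_inversion_diff) auto
  qed
  have int_i: "integrable \<mu> ?i"
    using assms(1,2) integrable_inversion by auto
  have int: "integrable \<mu> ?g"
    by (rule Bochner_Integration.integrable_diff[OF integrable_mult_right[OF integrable_weighted(1)[OF assms(1,2)]]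
        integrable_inner_left[OF int_i]])
  have nonneg: "AE u in \<mu>. 0 \<le> ?g u"
    using ne
  proof eventually_elim
    case (elim u)
    have "?i u \<bullet> e \<le> norm (?i u) * norm e"
      by (rule norm_cauchy_schwarz)
    also have "\<dots> \<le> norm e * ?f u"
      using key[of u] elim by (metis mult.commute mult_left_mono norm_ge_zero)
    finally show ?case by simp
  qed
  have "integral\<^sup>L \<mu> ?g = norm e * integral\<^sup>L \<mu> ?f - (\<integral>u. ?i u \<bullet> e \<partial>\<mu>)"
    using Bochner_Integration.integral_diff[OF integrable_mult_right[OF integrable_weighted(1)[OF assms(1,2)]]
        integrable_inner_left[OF int_i]]
    by (simp only: integral_mult_right_zero)
  also have "(\<integral>u. ?i u \<bullet> e \<partial>\<mu>) = e \<bullet> e"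
    using int_i assms(1,2) integrable_inversion by (simp add: e_def V_def)
  also have "integral\<^sup>L \<mu> ?f = ?d / 2 * ((n / m) * S q + (m / n) * S q')"
    by (rule integrable_weighted(2)[OF assms(1,2)])
  finally have I: "integral\<^sup>L \<mu> ?g = norm e * (?d / 2 * ((n / m) * S q + (m / n) * S q') - norm e)"
    by (simp only: right_diff_distrib dot_square_norm power2_eq_square)
  have "p * (?d / 2 * ((n / m) * S q + (m / n) * S q')) \<le> p * norm e"
    unfolding e_def eq using assms(3-7) by (intro weighted_bound) auto
  then have "integral\<^sup>L \<mu> ?g \<le> 0"
    unfolding I using assms(5) e by (intro mult_nonneg_nonpos) auto
  moreover have "integral\<^sup>L \<mu> ?g \<ge> 0"
    using nonneg by (rule integral_nonneg_AE)
  ultimately have "integral\<^sup>L \<mu> ?g = 0"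
    by linarith
  then have "AE u in \<mu>. ?g u = 0"
    using integral_nonneg_eq_0_iff_AE[OF int nonneg] by blast
  with ne show "AE u in \<mu>. q \<noteq> axis_point u \<and> q' \<noteq> axis_point u \<and>
      m * norm (q - axis_point u) = n * norm (q' - axis_point u) \<and> (\<exists>t>0. ?i u = t *\<^sub>R e)"
  proof eventually_elim
    case (elim u)
    note k = key[OF elim(1,2)]
    have "?i u \<bullet> e \<le> norm (?i u) * norm e"
      by (rule norm_cauchy_schwarz)
    moreover have "norm (?i u) * norm e \<le> norm e * ?f u"
      using k by (metis mult.commute mult_left_mono norm_ge_zero)
    ultimately have 1: "?i u \<bullet> e = norm (?i u) * norm e" and 2: "norm (?i u) * norm e = norm e * ?f u"
      using elim(3) by linarith+
    from 1 have par: "norm (?i u) *\<^sub>R e = norm e *\<^sub>R ?i u"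
      by (simp only: norm_cauchy_schwarz_eq)
    have "norm (?i u) > 0"
      using k(2) d elim by simp
    moreover have "?i u = (norm (?i u) / norm e) *\<^sub>R e"
      using arg_cong[OF par, of "\<lambda>x. x /\<^sub>R norm e"] e by (simp add: divide_inverse mult.commute)
    ultimately have t: "\<exists>t>0. ?i u = t *\<^sub>R e"
      using e by (intro exI[of _ "norm (?i u) / norm e"]) auto
    have "norm e * norm (?i u) = norm e * ?f u"
      using 2 by (simp only: mult.commute)
    then have "norm (?i u) = ?f u"
      by (rule iffD1[OF mult_left_cancel[OF less_imp_neq[OF e, symmetric]]])
    then have "?d / 2 * (2 / (norm (q - axis_point u) * norm (q' - axis_point u))) = ?f u"
      unfolding k(2) times_divide_times_eq by (simp only: mult.commute mult_divide_mult_cancel_left_if) simp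
    then have "2 / (norm (q - axis_point u) * norm (q' - axis_point u))
      = (n / m) / (norm (q - axis_point u))\<^sup>2 + (m / n) / (norm (q' - axis_point u))\<^sup>2"
      by (rule iffD1[OF mult_left_cancel[OF less_imp_neq[OF half_gt_zero[OF d], symmetric]]])
    then have "m * norm (q - axis_point u) = n * norm (q' - axis_point u)"
      using elim(1,2) by (intro two_divide_le(2)[OF assms(3,4)]) simp_all
    then show ?case
      using t elim(1,2) by blast
  qed
qed

section \<open>Rigidity\<close>

text \<open>The imaginary part and the second coordinate of \<open>q - axis_point u\<close> do not
  depend on u, so they leave the integral and only S remains; the real part is the one new
  integral.\<close>

lemma V_components:
  assumes "regular q"
  shows Re_V: "Re (fst (V q)) = (\<integral>u. (Re (fst q) - u) / (norm (q - axis_point u))\<^sup>2 \<partial>\<mu>)"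
    and Im_V: "Im (fst (V q)) = Im (fst q) * S q"
    and snd_V: "snd (V q) = snd q * S q"
proof -
  note int = integrable_inversion[OF assms]
  have "bounded_linear (\<lambda>z::complex \<times> real. Re (fst z))" "bounded_linear (\<lambda>z::complex \<times> real. Im (fst z))"
    by (intro bounded_linear_compose[OF bounded_linear_Re] bounded_linear_compose[OF bounded_linear_Im] bounded_linear_fst)+
  note bl = this bounded_linear_snd
  show "Re (fst (V q)) = (\<integral>u. (Re (fst q) - u) / (norm (q - axis_point u))\<^sup>2 \<partial>\<mu>)"
    unfolding V_def integral_bounded_linear[OF bl(1) int, symmetric]
    by (simp add: inversion_def divide_inverse mult.commute)
  show "Im (fst (V q)) = Im (fst q) * S q"
    unfolding V_def integral_bounded_linear[OF bl(2) int, symmetric]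
    by (simp add: inversion_def divide_inverse mult.commute S_def)
  show "snd (V q) = snd q * S q"
    unfolding V_def integral_bounded_linear[OF bl(3) int, symmetric]
    by (simp add: inversion_def divide_inverse mult.commute S_def)
qed

lemma norm_W:
  assumes "regular q"
  shows "(norm (W q))\<^sup>2 = (Re (fst (V q)))\<^sup>2 + (Im (fst q) * S q - 1)\<^sup>2 + (snd q * S q)\<^sup>2"
  unfolding W_def using V_components[OF assms]
  by (cases "V q") (simp add: norm_Pair cmod_power2)

text \<open>Where \<open>snd q > 0\<close> and \<open>p > 0\<close>, the inequality in \<open>good p q\<close> says that the second coordinate of
  \<open>subord p q\<close>, which is the imaginary part of \<open>H\<^sub>1\<^sub>1\<close>, is nonnegative.\<close>

definition good :: "real \<Rightarrow> complex \<times> real \<Rightarrow> bool" where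
  "good p q \<longleftrightarrow> regular q \<and> W q \<noteq> 0 \<and> p * S q \<le> (norm (W q))\<^sup>2"

definition subord :: "real \<Rightarrow> complex \<times> real \<Rightarrow> complex \<times> real" where
  "subord p q = q - p *\<^sub>R inversion (W q)"

lemma norm_inversion_W_diff:
  assumes "good p q" "good p q'"
  shows "norm (p *\<^sub>R inversion (W q) - p *\<^sub>R inversion (W q')) = \<bar>p\<bar> * norm (V q - V q') / (norm (W q) * norm (W q'))"
proof -
  have "norm (p *\<^sub>R inversion (W q) - p *\<^sub>R inversion (W q')) = \<bar>p\<bar> * norm (inversion (W q) - inversion (W q'))"
    by (metis norm_scaleR scaleR_diff_right)
  also have "norm (inversion (W q) - inversion (W q')) = norm (W q - W q') / (norm (W q) * norm (W q'))"
    using assms by (intro norm_inversion_diff) (auto simp: good_def)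
  also have "W q - W q' = V q - V q'"
    by (simp add: W_def)
  finally show ?thesis by simp
qed

text \<open>The factor 2 is 1 for the identity plus 1 for the subtracted term.\<close>

lemma subord_lipschitz:
  assumes "p > 0" "good p q" "good p q'"
  shows "norm (subord p q - subord p q') \<le> 2 * norm (q - q')"
proof -
  have "p * norm (V q - V q') \<le> norm (W q) * norm (W q') * norm (q - q')"
    using assms by (intro contraction) (auto simp: good_def)
  then have "norm (p *\<^sub>R inversion (W q) - p *\<^sub>R inversion (W q')) \<le> norm (q - q')"
    unfolding norm_inversion_W_diff[OF assms(2,3)] using assms
    by (simp add: good_def divide_le_eq mult.commute)
  moreover have "subord p q - subord p q' = (q - q') - (p *\<^sub>R inversion (W q) - p *\<^sub>R inversion (W q'))"
    by (simp add: subord_def)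
  ultimately show ?thesis
    using norm_triangle_ineq4[of "q - q'" "p *\<^sub>R inversion (W q) - p *\<^sub>R inversion (W q')"] by simp
qed

lemma AE_two_points:
  assumes "\<not> point_mass \<mu>" "AE u in \<mu>. P u"
  obtains u v where "u \<noteq> v" "P u" "P v"
proof -
  have "\<exists>u. P u"
  proof (rule ccontr)
    assume "\<nexists>u. P u"
    with assms(2) have "AE u in \<mu>. False"
      by simp
    then show False by simp
  qed
  then obtain u where u: "P u" by blast
  have "\<exists>v. v \<noteq> u \<and> P v"
  proof (rule ccontr)
    assume "\<nexists>v. v \<noteq> u \<and> P v"
    with assms(2) have "AE v in \<mu>. v \<in> {u}"
      by (auto elim: eventually_mono)
    then have "prob {u} = 1"
      by (subst (asm) AE_in_set_eq_1) (simp_all add: sets_eq)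
    with assms(1) show False
      by (auto simp: point_mass_def)
  qed
  with u that show thesis by blast
qed

text \<open>Equality in the contraction estimate forces \<open>\<bar>q - u\<bar>\<close> and \<open>\<bar>q' - u\<bar>\<close> to be proportional in
  \<open>u\<close>, and \<open>inversion (q - u) - inversion (q' - u)\<close> to have a constant direction. On two points
  \<open>u \<noteq> v\<close> this is only possible if \<open>q'\<close> arises from \<open>q\<close> by a rotation about the axis.\<close>

lemma proportional_coordinates:
  fixes a a' k k' u v m n e s t :: real
  assumes "m > 0" "n > 0" "u \<noteq> v" "s > 0" "t > 0"
    and u: "m\<^sup>2 * ((a - u)\<^sup>2 + k) = n\<^sup>2 * ((a' - u)\<^sup>2 + k')"
    and v: "m\<^sup>2 * ((a - v)\<^sup>2 + k) = n\<^sup>2 * ((a' - v)\<^sup>2 + k')"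
    and s: "m\<^sup>2 * (a - u) - n\<^sup>2 * (a' - u) = s * e"
    and t: "m\<^sup>2 * (a - v) - n\<^sup>2 * (a' - v) = t * e"
  shows "m = n \<and> a = a' \<and> k = k'"
proof -
  \<comment> \<open>The difference of the two distance equations contains the factor v - u; the
    other factor is the sum of the two direction equations, that is (s + t) e. As s and t have the
    same sign, e must vanish.\<close>
  have "(v - u) * (m\<^sup>2 * (2 * a - u - v) - n\<^sup>2 * (2 * a' - u - v)) = 0"
    using u v by (simp add: algebra_simps power2_eq_square)
  then have "m\<^sup>2 * (2 * a - u - v) - n\<^sup>2 * (2 * a' - u - v) = 0"
    using assms(3) by simp
  then have "(s + t) * e = 0"
    using s t by (simp add: algebra_simps)
  then have "e = 0"
    using assms(4,5) by simp
  then have "m\<^sup>2 * (a - u) - n\<^sup>2 * (a' - u) = 0" "m\<^sup>2 * (a - v) - n\<^sup>2 * (a' - v) = 0"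
    using s t by auto
  then have "(m\<^sup>2 - n\<^sup>2) * (v - u) = 0"
    by (simp add: algebra_simps)
  then have mn: "m\<^sup>2 = n\<^sup>2"
    using assms(3) by simp
  then have "m = n"
    using assms(1,2) by (simp add: power2_eq_iff_nonneg)
  moreover have "a = a'"
    using \<open>m\<^sup>2 * (a - u) - n\<^sup>2 * (a' - u) = 0\<close> mn assms(2) by (simp add: right_diff_distrib[symmetric])
  ultimately show ?thesis
    using u assms(2) by simp
qed

text \<open>Equal images mean that the subtracted terms differ by q - q', so the contraction
  estimate is attained. What survives is a rotation about the axis; the shift by (\<i>, 0) in
  \<open>W\<close> breaks this symmetry up to a reflection, and the sign of the second coordinate
  excludes the reflection.\<close>

lemma subord_inj:
  assumes np: "\<not> point_mass \<mu>" and p: "p > 0"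
    and good: "good p q" "good p q'" and nonneg: "snd q \<ge> 0" "snd q' \<ge> 0"
    and eq: "subord p q = subord p q'"
  shows "q = q'"
proof (rule ccontr)
  assume ne: "q \<noteq> q'"
  define m n where "m = norm (W q)" and "n = norm (W q')"
  have pos: "m > 0" "n > 0" and reg: "regular q" "regular q'"
    and le: "p * S q \<le> m\<^sup>2" "p * S q' \<le> n\<^sup>2"
    using good by (auto simp: good_def m_def n_def)
  have "q - q' = p *\<^sub>R inversion (W q) - p *\<^sub>R inversion (W q')"
    using eq by (simp add: subord_def algebra_simps)
  then have "norm (q - q') = p * norm (V q - V q') / (m * n)"
    using norm_inversion_W_diff[OF good] p by (simp add: m_def n_def)
  then have "p * norm (V q - V q') = m * n * norm (q - q')"
    using pos by simp
  from contraction_equality[OF reg pos p le ne this]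
  obtain e where "AE u in \<mu>. q \<noteq> axis_point u \<and> q' \<noteq> axis_point u \<and>
      m * norm (q - axis_point u) = n * norm (q' - axis_point u) \<and>
      (\<exists>t>0. inversion (q - axis_point u) - inversion (q' - axis_point u) = t *\<^sub>R e)"
    by blast
  from AE_two_points[OF np this] obtain u v where "u \<noteq> v"
    and u: "q \<noteq> axis_point u \<and> q' \<noteq> axis_point u \<and>
      m * norm (q - axis_point u) = n * norm (q' - axis_point u) \<and>
      (\<exists>t>0. inversion (q - axis_point u) - inversion (q' - axis_point u) = t *\<^sub>R e)"
    and v: "q \<noteq> axis_point v \<and> q' \<noteq> axis_point v \<and>
      m * norm (q - axis_point v) = n * norm (q' - axis_point v) \<and>
      (\<exists>t>0. inversion (q - axis_point v) - inversion (q' - axis_point v) = t *\<^sub>R e)"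
    by metis
  define a a' where "a = Re (fst q)" and "a' = Re (fst q')"
  define k k' where "k = (Im (fst q))\<^sup>2 + (snd q)\<^sup>2" and "k' = (Im (fst q'))\<^sup>2 + (snd q')\<^sup>2"
  note defs = a_def a'_def k_def k'_def
  have coord: "m\<^sup>2 * ((a - w)\<^sup>2 + k) = n\<^sup>2 * ((a' - w)\<^sup>2 + k') \<and>
      (\<exists>s>0. m\<^sup>2 * (a - w) - n\<^sup>2 * (a' - w) = s * Re (fst e))"
    if ne: "q \<noteq> axis_point w" "q' \<noteq> axis_point w"
      and pr: "m * norm (q - axis_point w) = n * norm (q' - axis_point w)"
      and t: "t > 0" "inversion (q - axis_point w) - inversion (q' - axis_point w) = t *\<^sub>R e"
    for w t
  proof -
    define r r' where "r = norm (q - axis_point w)" and "r' = norm (q' - axis_point w)"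
    have r: "r > 0" "r' > 0"
      using ne by (auto simp: r_def r'_def)
    have r2: "r\<^sup>2 = (a - w)\<^sup>2 + k" "r'\<^sup>2 = (a' - w)\<^sup>2 + k'"
      by (simp_all add: r_def r'_def defs norm_axis_diff_Re_Im)
    have mr: "m\<^sup>2 * r\<^sup>2 = n\<^sup>2 * r'\<^sup>2"
      using pr by (metis power_mult_distrib r_def r'_def)
    have "Re (fst (inversion (q - axis_point w) - inversion (q' - axis_point w))) = t * Re (fst e)"
      using t(2) by simp
    then have "(a - w) / r\<^sup>2 - (a' - w) / r'\<^sup>2 = t * Re (fst e)"
      by (simp add: inversion_def defs r_def r'_def divide_inverse mult.commute)
    \<comment> \<open>Both denominators are cleared by the common value m^2 r^2 = n^2 r'^2; the
      factor t becomes m^2 r^2 t, which is still positive.\<close>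
    then have "m\<^sup>2 * r\<^sup>2 * ((a - w) / r\<^sup>2) - n\<^sup>2 * r'\<^sup>2 * ((a' - w) / r'\<^sup>2) = m\<^sup>2 * r\<^sup>2 * (t * Re (fst e))"
      by (metis mr right_diff_distrib)
    then have "m\<^sup>2 * (a - w) - n\<^sup>2 * (a' - w) = (m\<^sup>2 * r\<^sup>2 * t) * Re (fst e)"
      using r by simp
    moreover have "m\<^sup>2 * r\<^sup>2 * t > 0"
      using pos r t by simp
    ultimately show ?thesis
      using mr r2 by metis
  qed
  obtain s t where "s > 0" "t > 0"
    and "m\<^sup>2 * ((a - u)\<^sup>2 + k) = n\<^sup>2 * ((a' - u)\<^sup>2 + k')" "m\<^sup>2 * ((a - v)\<^sup>2 + k) = n\<^sup>2 * ((a' - v)\<^sup>2 + k')"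
    and "m\<^sup>2 * (a - u) - n\<^sup>2 * (a' - u) = s * Re (fst e)" "m\<^sup>2 * (a - v) - n\<^sup>2 * (a' - v) = t * Re (fst e)"
    using coord[of u] coord[of v] u v by meson
  from proportional_coordinates[OF pos \<open>u \<noteq> v\<close> this]
  have mn: "m = n" and a: "a = a'" and k: "k = k'"
    by auto
  have nrm: "(norm (q - axis_point w))\<^sup>2 = (norm (q' - axis_point w))\<^sup>2" for w
    using a k by (simp add: norm_axis_diff_Re_Im defs)
  have S: "S q = S q'" and Re: "Re (fst (V q)) = Re (fst (V q'))"
    using a unfolding Re_V[OF reg(1)] Re_V[OF reg(2)] S_def nrm defs by simp_all
  have "(norm (W q))\<^sup>2 = (norm (W q'))\<^sup>2"
    using mn by (simp add: m_def n_def)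
  \<comment> \<open>Once \<open>S\<close>, the real part of \<open>V\<close> and the distance k from
    the axis agree, |W|^2 sees q only through the mixed term -2 Im (fst q) S(q) produced by (\<i>,
    0).\<close>
  then have "k * (S q)\<^sup>2 - 2 * Im (fst q) * S q = k' * (S q')\<^sup>2 - 2 * Im (fst q') * S q'"
    unfolding norm_W[OF reg(1)] norm_W[OF reg(2)] Re defs
    by (simp add: power_mult_distrib power2_diff distrib_right mult.assoc)
  then have Im: "Im (fst q) = Im (fst q')"
    using S k S_pos[OF reg(2)] by simp
  with k have "(snd q)\<^sup>2 = (snd q')\<^sup>2"
    by (simp add: defs)
  with nonneg have "snd q = snd q'"
    by (simp add: power2_eq_iff_nonneg)
  with Im a have "q = q'"
    by (simp add: prod_eq_iff complex_eq_iff defs)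
  with ne show False by simp
qed

section \<open>The height function\<close>

text \<open>The inequality in \<open>good p q\<close> becomes p \<le> \<open>level q\<close> for
  regular q, and at (z, d) with d > 0 the quotient Im H11 / d equals 1 - p / level (z, d). The level
  itself does not involve p.\<close>

definition level :: "complex \<times> real \<Rightarrow> real" where
  "level q = (norm (W q))\<^sup>2 / S q"

section \<open>Monotonicity and growth of the level along vertical lines\<close>

lemma integrable_second_moment:
  assumes "snd q \<noteq> 0"
  shows "integrable \<mu> (\<lambda>u. (Re (fst q) - u)\<^sup>2 / (norm (q - axis_point u))\<^sup>2)"
proof (rule integrable_const_bound[where B=1])
  have "(\<lambda>u. u) \<in> borel_measurable \<mu>"
    using measurable_ident_sets[OF sets_eq] by (simp add: id_def)
  then show "(\<lambda>u. (Re (fst q) - u)\<^sup>2 / (norm (q - axis_point u))\<^sup>2) \<in> borel_measurable \<mu>"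
    by measurable
  have "(Re (fst q) - u)\<^sup>2 / (norm (q - axis_point u))\<^sup>2 \<le> 1" for u
    unfolding norm_axis_diff_Re_Im by (rule divide_le_eq_1[THEN iffD2]) (smt (verit) zero_le_power2)
  then show "AE u in \<mu>. norm ((Re (fst q) - u)\<^sup>2 / (norm (q - axis_point u))\<^sup>2) \<le> 1"
    by simp
qed

lemma integrable_first_moment:
  assumes "regular q"
  shows "integrable \<mu> (\<lambda>u. (Re (fst q) - u) / (norm (q - axis_point u))\<^sup>2)"
proof -
  have "integrable \<mu> (\<lambda>u. Re (fst (inversion (q - axis_point u))))"
    using integrable_inversion[OF assms]
    by (intro integrable_bounded_linear[OF bounded_linear_Re] integrable_bounded_linear[OF bounded_linear_fst])
  then show ?thesis
    by (simp add: inversion_def divide_inverse mult.commute)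
qed

lemma norm_axis_diff_pos: "snd q \<noteq> 0 \<Longrightarrow> (norm (q - axis_point u))\<^sup>2 > 0"
  by (auto simp: norm_axis_diff intro!: add_nonneg_pos)

text \<open>Expand the square and use (Re (fst q) - u)^2 = |q - u|^2 - (Im (fst q))^2 - (snd q)^2.
  The right side is a parabola in t whose minimum occurs, negated, in the level, while for fixed t
  the integrand on the left decreases (weakly) as |snd q| grows. The separate terms of
  \<open>level_eq\<close> show no such monotonicity.\<close>

lemma shifted_second_moment:
  assumes "snd q \<noteq> 0"
  shows "integrable \<mu> (\<lambda>u. (Re (fst q) - u - t)\<^sup>2 / (norm (q - axis_point u))\<^sup>2)"
    and "(\<integral>u. (Re (fst q) - u - t)\<^sup>2 / (norm (q - axis_point u))\<^sup>2 \<partial>\<mu>) =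
      1 - ((Im (fst q))\<^sup>2 + (snd q)\<^sup>2) * S q - 2 * t * Re (fst (V q)) + t\<^sup>2 * S q"
proof -
  let ?w = "\<lambda>u. (norm (q - axis_point u))\<^sup>2" and ?a = "Re (fst q)"
  let ?c = "(Im (fst q))\<^sup>2 + (snd q)\<^sup>2"
  have reg: "regular q"
    using assms by (rule regular_snd)
  have "(?a - u - t)\<^sup>2 = (?a - u)\<^sup>2 - (2 * t) * (?a - u) + t\<^sup>2" for u
    by (simp add: power2_eq_square algebra_simps)
  then have eq: "(?a - u - t)\<^sup>2 / ?w u = (?a - u)\<^sup>2 / ?w u - (2 * t) * ((?a - u) / ?w u) + t\<^sup>2 * (1 / ?w u)" for u
    by (simp add: add_divide_distrib diff_divide_distrib right_diff_distrib)
  note ints = integrable_second_moment[OF assms] integrable_mult_right[OF integrable_first_moment[OF reg], of "2 * t"]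
    integrable_mult_right[OF conjunct1[OF reg[unfolded regular_def]], of "t\<^sup>2"]
  show "integrable \<mu> (\<lambda>u. (?a - u - t)\<^sup>2 / ?w u)"
    unfolding eq by (rule Bochner_Integration.integrable_add[OF Bochner_Integration.integrable_diff]) (rule ints)+
  have "(\<integral>u. (?a - u - t)\<^sup>2 / ?w u \<partial>\<mu>) = (\<integral>u. (?a - u)\<^sup>2 / ?w u \<partial>\<mu>) - 2 * t * Re (fst (V q)) + t\<^sup>2 * S q"
    unfolding eq
    by (subst Bochner_Integration.integral_add[OF Bochner_Integration.integrable_diff[OF ints(1,2)] ints(3)],
        subst Bochner_Integration.integral_diff[OF ints(1,2)])
      (simp only: integral_mult_right_zero Re_V[OF reg] S_def)
  moreover have "(?a - u)\<^sup>2 / ?w u = 1 - ?c * (1 / ?w u)" for u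
  proof -
    have "(?a - u)\<^sup>2 = ?w u - ?c"
      by (simp add: norm_axis_diff_Re_Im)
    then show ?thesis
      using norm_axis_diff_pos[OF assms, of u] by (simp add: diff_divide_distrib)
  qed
  then have "(\<integral>u. (?a - u)\<^sup>2 / ?w u \<partial>\<mu>) = (\<integral>u. 1 - ?c * (1 / ?w u) \<partial>\<mu>)"
    by (simp only:)
  moreover have "\<dots> = 1 - ?c * S q"
    using reg unfolding regular_def
    by (subst Bochner_Integration.integral_diff) (auto simp only: integral_mult_right_zero S_def integrable_const
        integrable_mult_right lebesgue_integral_const prob_space scaleR_one mult_1_left real_scaleR_def)
  ultimately show "(\<integral>u. (?a - u - t)\<^sup>2 / ?w u \<partial>\<mu>) = 1 - ?c * S q - 2 * t * Re (fst (V q)) + t\<^sup>2 * S q"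
    by simp
qed

lemma level_eq:
  assumes "regular q"
  shows "level q = (Re (fst (V q)))\<^sup>2 / S q + ((Im (fst q))\<^sup>2 + (snd q)\<^sup>2) * S q - 2 * Im (fst q) + 1 / S q"
  using S_pos[OF assms] unfolding level_def norm_W[OF assms]
  by (simp add: field_simps power2_eq_square)

lemma S_less:
  assumes "0 < d" "d < d'"
  shows "S (z, d') < S (z, d)"
  unfolding S_def
proof (rule integral_less_AE_space)
  show "integrable \<mu> (\<lambda>u. 1 / (norm ((z, d') - axis_point u))\<^sup>2)" "integrable \<mu> (\<lambda>u. 1 / (norm ((z, d) - axis_point u))\<^sup>2)"
    using regular_snd[of "(z, d')"] regular_snd[of "(z, d)"] assms by (auto simp: regular_def)
  have "d\<^sup>2 < d'\<^sup>2"
    using assms by (intro power_strict_mono) auto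
  then show "AE u in \<mu>. 1 / (norm ((z, d') - axis_point u))\<^sup>2 < 1 / (norm ((z, d) - axis_point u))\<^sup>2"
    using assms unfolding norm_axis_diff
    by (intro AE_I2 divide_strict_left_mono) (auto intro!: mult_pos_pos add_nonneg_pos)
  show "emeasure \<mu> (space \<mu>) \<noteq> 0"
    by (simp add: emeasure_space_1)
qed

text \<open>By the computation above, \<open>level q = 1 - 2 Im z + 1 / S q - min\<^sub>t (second moment about t)\<close>,
  and all terms are monotone in the second coordinate of \<open>q\<close>.\<close>

lemma level_strict_mono:
  assumes "0 < d" "d < d'"
  shows "level (z, d) < level (z, d')"
proof -
  let ?q = "(z, d)" and ?q' = "(z, d')"
  define t where "t = Re (fst (V ?q)) / S ?q"
  have reg: "regular ?q" "regular ?q'"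
    using assms by (auto intro: regular_snd)
  note pos = S_pos[OF reg(1)] S_pos[OF reg(2)]
  have lev: "level q = 1 - 2 * Im (fst q) + 1 / S q -
      (1 - ((Im (fst q))\<^sup>2 + (snd q)\<^sup>2) * S q - (Re (fst (V q)))\<^sup>2 / S q)" if "regular q" for q
    using level_eq[OF that] by simp
  \<comment> \<open>The number t minimises the parabola at the lower point \<open>?q\<close>. At
    \<open>?q'\<close> its value is merely an upper bound for the minimum, by completing the square,
    and this is the direction needed.\<close>
  have "0 \<le> S ?q' * (t - Re (fst (V ?q')) / S ?q')\<^sup>2"
    using pos by simp
  also have "\<dots> = t\<^sup>2 * S ?q' - 2 * t * Re (fst (V ?q')) + (Re (fst (V ?q')))\<^sup>2 / S ?q'"
    using pos by (simp add: power2_eq_square field_simps)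
  finally have 1: "1 - ((Im z)\<^sup>2 + d'\<^sup>2) * S ?q' - (Re (fst (V ?q')))\<^sup>2 / S ?q'
      \<le> 1 - ((Im z)\<^sup>2 + d'\<^sup>2) * S ?q' - 2 * t * Re (fst (V ?q')) + t\<^sup>2 * S ?q'"
    by simp
  also have "\<dots> = (\<integral>u. (Re z - u - t)\<^sup>2 / (norm (?q' - axis_point u))\<^sup>2 \<partial>\<mu>)"
    using shifted_second_moment(2)[of ?q' t] assms by simp
  also have "\<dots> \<le> (\<integral>u. (Re z - u - t)\<^sup>2 / (norm (?q - axis_point u))\<^sup>2 \<partial>\<mu>)"
  proof (rule integral_mono)
    show "integrable \<mu> (\<lambda>u. (Re z - u - t)\<^sup>2 / (norm (?q' - axis_point u))\<^sup>2)"
      "integrable \<mu> (\<lambda>u. (Re z - u - t)\<^sup>2 / (norm (?q - axis_point u))\<^sup>2)"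
      using shifted_second_moment(1)[of ?q' t] shifted_second_moment(1)[of ?q t] assms by auto
    have "d\<^sup>2 \<le> d'\<^sup>2"
      using assms by (intro power_mono) auto
    then show "(Re z - u - t)\<^sup>2 / (norm (?q' - axis_point u))\<^sup>2 \<le> (Re z - u - t)\<^sup>2 / (norm (?q - axis_point u))\<^sup>2" for u
      using assms unfolding norm_axis_diff
      by (intro divide_left_mono) (auto intro!: mult_pos_pos add_nonneg_pos)
  qed
  also have "\<dots> = 1 - ((Im z)\<^sup>2 + d\<^sup>2) * S ?q - 2 * t * Re (fst (V ?q)) + t\<^sup>2 * S ?q"
    using shifted_second_moment(2)[of ?q t] assms by simp
  also have "\<dots> = 1 - ((Im z)\<^sup>2 + d\<^sup>2) * S ?q - (Re (fst (V ?q)))\<^sup>2 / S ?q"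
    using pos unfolding t_def by (simp add: power2_eq_square field_simps)
  finally have "1 - ((Im z)\<^sup>2 + d'\<^sup>2) * S ?q' - (Re (fst (V ?q')))\<^sup>2 / S ?q'
      \<le> 1 - ((Im z)\<^sup>2 + d\<^sup>2) * S ?q - (Re (fst (V ?q)))\<^sup>2 / S ?q" .
  moreover have "1 / S ?q < 1 / S ?q'"
    using pos S_less[OF assms] by (simp add: divide_strict_left_mono)
  ultimately show ?thesis
    unfolding lev[OF reg(1)] lev[OF reg(2)] by simp
qed

lemma S_le:
  assumes "snd q \<noteq> 0"
  shows "S q \<le> 1 / (snd q)\<^sup>2"
proof -
  have "S q \<le> (\<integral>u. 1 / (snd q)\<^sup>2 \<partial>\<mu>)"
    unfolding S_def
  proof (rule integral_mono)
    show "integrable \<mu> (\<lambda>u. 1 / (norm (q - axis_point u))\<^sup>2)"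
      using regular_snd[OF assms] by (simp add: regular_def)
    show "1 / (norm (q - axis_point u))\<^sup>2 \<le> 1 / (snd q)\<^sup>2" for u
      using assms by (intro divide_left_mono) (auto simp: norm_axis_diff intro!: mult_pos_pos add_nonneg_pos)
  qed simp
  then show ?thesis
    by (simp add: prob_space)
qed

text \<open>Two terms of \<open>level_eq\<close> are nonnegative, and 1 / S(q) \<ge> (snd q)^2. The
  bound provides the upper endpoint in the intermediate value argument for the height.\<close>

lemma level_ge:
  assumes "snd q \<noteq> 0"
  shows "level q \<ge> (snd q)\<^sup>2 - 2 * \<bar>Im (fst q)\<bar>"
proof -
  have reg: "regular q"
    using assms by (rule regular_snd)
  note pos = S_pos[OF reg]
  have "(snd q)\<^sup>2 \<le> 1 / S q"
    using S_le[OF assms] pos assms by (simp add: field_simps)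
  moreover have "(Re (fst (V q)))\<^sup>2 / S q \<ge> 0" "((Im (fst q))\<^sup>2 + (snd q)\<^sup>2) * S q \<ge> 0"
    using pos by auto
  ultimately show ?thesis
    unfolding level_eq[OF reg] by linarith
qed

section \<open>Joint continuity in the open half-space\<close>

lemma continuous_on_V: "continuous_on {q. snd q > 0} V"
  unfolding continuous_on_def
proof
  fix q0 :: "complex \<times> real"
  assume "q0 \<in> {q. snd q > 0}"
  then have q0: "snd q0 > 0" by simp
  have bound: "norm (V q - V q0) \<le> norm (q - q0) / (snd q * snd q0)" if "snd q > 0" for q
  proof -
    have "snd q \<le> norm (q - axis_point u)" if "snd q > 0" for q u
      by (rule power2_le_imp_le) (simp_all only: norm_axis_diff norm_ge_zero le_add_same_cancel2 zero_le_power2)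
    then have "norm (V q - V q0) \<le> (\<integral>u. norm (q - q0) / (snd q * snd q0) \<partial>\<mu>)"
      using that q0
      by (intro norm_V_diff_le_integral regular_snd AE_I2 divide_left_mono mult_mono mult_pos_pos)
        (auto intro: less_le_trans)
    then show ?thesis
      by (simp add: prob_space)
  qed
  have "((\<lambda>q. norm (q - q0) / (snd q * snd q0)) \<longlongrightarrow> norm (q0 - q0) / (snd q0 * snd q0)) (at q0 within {q. snd q > 0})"
    using q0 by (intro tendsto_divide[OF tendsto_norm[OF tendsto_diff[OF tendsto_ident_at tendsto_const]]
        tendsto_mult[OF tendsto_snd[OF tendsto_ident_at] tendsto_const]]) simp
  then have "((\<lambda>q. norm (q - q0) / (snd q * snd q0)) \<longlongrightarrow> 0) (at q0 within {q. snd q > 0})"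
    by simp
  then have "((\<lambda>q. V q - V q0) \<longlongrightarrow> 0) (at q0 within {q. snd q > 0})"
    by (rule Lim_null_comparison[rotated]) (auto simp: eventually_at_filter bound)
  then show "(V \<longlongrightarrow> V q0) (at q0 within {q. snd q > 0})"
    by (simp add: LIM_zero_iff)
qed

lemma continuous_on_level: "continuous_on {q. snd q > 0} level"
proof -
  \<comment> \<open>Writing \<open>S q\<close> as \<open>snd (V q) / snd q\<close> reduces
    everything to the continuity of \<open>V\<close>.\<close>
  have "continuous_on {q. snd q > 0} (\<lambda>q. (norm (V q - (\<i>, 0)))\<^sup>2 / (snd (V q) / snd q))"
  proof (intro continuous_intros continuous_on_V ballI)
    fix q :: "complex \<times> real"
    assume "q \<in> {q. snd q > 0}"
    then have "regular q" "snd q > 0"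
      using regular_snd by auto
    then show "snd q \<noteq> 0" "snd (V q) / snd q \<noteq> 0"
      using S_pos[of q] by (auto simp: snd_V)
  qed
  then show ?thesis
    by (rule continuous_on_cong[THEN iffD1, rotated 2]) (auto simp: level_def W_def snd_V regular_snd)
qed

text \<open>The set \<open>domD\<close> in terms of the level: as 1 - p / level (z, d) increases
  with d, its limit at 0 is negative as soon as one value is.\<close>

definition base :: "real \<Rightarrow> complex set" where
  "base p = {z. \<exists>d>0. level (z, d) < p}"

lemma level_outside_base:
  assumes "z \<notin> base p" "d > 0"
  shows "p \<le> level (z, d)"
proof -
  have "\<not> level (z, d) < p"
    using assms unfolding base_def by blast
  then show ?thesis
    by simp
qed

definition height :: "real \<Rightarrow> complex \<Rightarrow> real" where
  "height p z = (if z \<in> base p then THE d. d > 0 \<and> level (z, d) = p else 0)"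

lemma ex1_height:
  assumes "z \<in> base p"
  shows "\<exists>!d. d > 0 \<and> level (z, d) = p"
proof -
  from assms obtain a where a: "a > 0" "level (z, a) < p"
    by (auto simp: base_def)
  \<comment> \<open>Chosen to make the bound b^2 - 2 |Im z| of \<open>level_ge\<close> at least p: b
    \<ge> 1 gives b^2 \<ge> b, and b \<ge> |p| + 2 |Im z|.\<close>
  define b where "b = a + \<bar>p\<bar> + 2 * \<bar>Im z\<bar> + 1"
  have b: "b \<ge> 1" "b \<ge> a" "b \<ge> \<bar>p\<bar> + 2 * \<bar>Im z\<bar>"
    using a by (auto simp: b_def)
  have "b \<le> b\<^sup>2"
    using b by (simp add: power2_eq_square)
  then have "p \<le> level (z, b)"
    using level_ge[of "(z, b)"] b by simp
  moreover have "continuous_on {a..b} (\<lambda>d. level (z, d))"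
    using a by (intro continuous_on_compose2[OF continuous_on_level] continuous_intros) auto
  ultimately obtain d where d: "a \<le> d" "d \<le> b" "level (z, d) = p"
    using IVT'[of "\<lambda>d. level (z, d)" a p b] a b by auto
  show ?thesis
  proof (rule ex1I[of _ d])
    show "d > 0 \<and> level (z, d) = p"
      using d a by simp
    show "d' = d" if "d' > 0 \<and> level (z, d') = p" for d'
      using level_strict_mono[of d d' z] level_strict_mono[of d' d z] that d a
      by (cases d d' rule: linorder_cases) auto
  qed
qed

lemma height_base:
  assumes "z \<in> base p"
  shows "height p z > 0" "level (z, height p z) = p"
  using theI'[OF ex1_height[OF assms]] assms by (auto simp: height_def)

lemma height_nonneg: "height p z \<ge> 0"
  using height_base(1)[of z p] by (cases "z \<in> base p") (auto simp: height_def)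

text \<open>Comparing the height with a fixed d > 0 becomes a strict inequality for level (z, d),
  which is an open condition on z. Continuity of the height follows without an implicit function
  argument, also across the boundary of \<open>base\<close>.\<close>

lemma level_gt_iff_height:
  assumes "d > 0"
  shows "level (z, d) > p \<longleftrightarrow> height p z < d"
    and "level (z, d) < p \<longleftrightarrow> d < height p z"
proof -
  show "level (z, d) > p \<longleftrightarrow> height p z < d"
  proof (cases "z \<in> base p")
    case True
    then show ?thesis
      using height_base[OF True] level_strict_mono[of d "height p z" z] level_strict_mono[of "height p z" d z] assms
      by (cases d "height p z" rule: linorder_cases) auto
  next
    case False
    \<comment> \<open>Off \<open>base\<close> only the weak inequality is at hand; taken at d / 2,
      it becomes strict at d.\<close>
    then have "p \<le> level (z, d / 2)"
      using half_gt_zero[OF assms] by (rule level_outside_base)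
    also have "\<dots> < level (z, d)"
      using assms by (intro level_strict_mono) auto
    finally show ?thesis
      using False assms by (simp add: height_def)
  qed
  show "level (z, d) < p \<longleftrightarrow> d < height p z"
  proof (cases "z \<in> base p")
    case True
    then show ?thesis
      using height_base[OF True] level_strict_mono[of d "height p z" z] level_strict_mono[of "height p z" d z] assms
      by (cases d "height p z" rule: linorder_cases) auto
  next
    case False
    then show ?thesis
      using assms by (auto simp: base_def height_def)
  qed
qed

lemma continuous_on_height: "continuous_on UNIV (height p)"
proof -
  have "(height p \<longlongrightarrow> height p z) (at z)" for z
  proof (rule order_tendstoI)
    have "isCont (\<lambda>z. level (z, d)) z" if "d > 0" for d
    proof -
      have "continuous_on UNIV (\<lambda>z. level (z, d))"
        using that by (intro continuous_on_compose2[OF continuous_on_level] continuous_intros) auto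
      then show ?thesis
        by (simp add: continuous_on_eq_continuous_at)
    qed
    then have lim: "((\<lambda>z. level (z, d)) \<longlongrightarrow> level (z, d)) (at z)" if "d > 0" for d
      using that by (simp add: isCont_def)
    show "\<forall>\<^sub>F x in at z. height p x < d" if "height p z < d" for d
    proof -
      have "d > 0"
        using that height_nonneg[of p z] by linarith
      moreover from this that have "level (z, d) > p"
        by (simp add: level_gt_iff_height)
      ultimately have "\<forall>\<^sub>F x in at z. level (x, d) > p"
        using order_tendstoD(1)[OF lim] by blast
      then show ?thesis
        using \<open>d > 0\<close> by (simp add: level_gt_iff_height)
    qed
    show "\<forall>\<^sub>F x in at z. d < height p x" if "d < height p z" for d
    proof (cases "d > 0")
      case True
      with that have "level (z, d) < p"
        by (simp add: level_gt_iff_height)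
      then have "\<forall>\<^sub>F x in at z. level (x, d) < p"
        using order_tendstoD(2)[OF lim[OF True]] by blast
      then show ?thesis
        using True by (simp add: level_gt_iff_height)
    next
      case False
      \<comment> \<open>The criterion requires a positive d. For d < 0 nonnegativity of the height
        suffices; for d = 0 the criterion is applied at half the height.\<close>
      have "height p z > 0 \<or> d < 0"
        using that False by linarith
      then show ?thesis
      proof
        assume "d < 0"
        then show ?thesis
          using height_nonneg by (intro always_eventually allI) (meson less_le_trans)
      next
        assume *: "height p z > 0"
        then have "level (z, height p z / 2) < p"
          by (subst level_gt_iff_height) auto
        then have "\<forall>\<^sub>F x in at z. level (x, height p z / 2) < p"
          using order_tendstoD(2)[OF lim] * half_gt_zero by blast
        then have "\<forall>\<^sub>F x in at z. height p z / 2 < height p x"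
          using * by (simp add: level_gt_iff_height)
        then show ?thesis
          by eventually_elim (use False * in linarith)
      qed
    qed
  qed
  then show ?thesis
    by (simp add: continuous_on_def)
qed

section \<open>Points of height zero\<close>

definition atom_mass :: "complex \<Rightarrow> real" where
  "atom_mass z = prob {u. complex_of_real u = z}"

lemma space_eq: "space \<mu> = UNIV"
  using sets_eq_imp_space_eq[OF sets_eq] by simp

lemma measurable_distance [measurable]: "(\<lambda>u. cmod (z - of_real u)) \<in> borel_measurable \<mu>"
  unfolding measurable_cong_sets[OF sets_eq refl]
  by (intro borel_measurable_continuous_onI continuous_intros)

lemma sets_atom [measurable]: "{u. complex_of_real u = z} \<in> sets \<mu>"
proof -
  have "{u \<in> space \<mu>. cmod (z - of_real u) = 0} \<in> sets \<mu>"
    by measurable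
  then show ?thesis
    by (simp add: space_eq eq_commute[of z])
qed

lemma sets_annulus [measurable]: "{u. 0 < cmod (z - of_real u) \<and> cmod (z - of_real u) < r} \<in> sets \<mu>"
proof -
  have "{u \<in> space \<mu>. 0 < cmod (z - of_real u) \<and> cmod (z - of_real u) < r} \<in> sets \<mu>"
    by measurable
  then show ?thesis
    by (simp add: space_eq)
qed

text \<open>The discs are punctured at z, so they decrease to the empty set even if z is an
  atom.\<close>

lemma small_annulus:
  assumes "\<eta> > 0"
  obtains r where "r > 0" "prob {u. 0 < cmod (z - of_real u) \<and> cmod (z - of_real u) < r} \<le> \<eta>"
proof -
  let ?A = "\<lambda>n::nat. {u. 0 < cmod (z - of_real u) \<and> cmod (z - of_real u) < 1 / Suc n}"
  have "(\<lambda>n. prob (?A n)) \<longlonglongrightarrow> prob (\<Inter>n. ?A n)"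
  proof (rule finite_Lim_measure_decseq)
    show "range ?A \<subseteq> sets \<mu>"
      by (intro image_subsetI sets_annulus)
    show "decseq ?A"
    proof (rule decseq_SucI, rule subsetI)
      fix n u
      assume "u \<in> ?A (Suc n)"
      moreover have "1 / real (Suc (Suc n)) \<le> 1 / real (Suc n)"
        by (simp add: field_simps)
      ultimately show "u \<in> ?A n"
        by auto
    qed
  qed
  also have "(\<Inter>n. ?A n) = {}"
  proof -
    have "\<exists>n. u \<notin> ?A n" for u
    proof (cases "z = of_real u")
      case False
      then obtain n where "1 / Suc n < cmod (z - of_real u)"
        using reals_Archimedean[of "cmod (z - of_real u)"] by (auto simp: divide_inverse)
      then show ?thesis
        by (intro exI[of _ n]) auto
    qed auto
    then show ?thesis
      by blast
  qed
  finally have "(\<lambda>n. prob (?A n)) \<longlonglongrightarrow> 0"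
    by simp
  then have "\<forall>\<^sub>F n in sequentially. prob (?A n) < \<eta>"
    using assms by (rule order_tendstoD)
  then obtain n where "prob (?A n) < \<eta>"
    using eventually_happens by force
  then show thesis
    by (intro that[of "1 / Suc n"]) auto
qed

text \<open>The coefficient of S is the point: for small d and \<eta> it is close to the mass at z.
  The second coordinate of V is d S, and d^2 S is at most this mass plus \<eta> plus d^2 / r^2. The
  first is at most 1 / r + sqrt(\<eta> S), since only the punctured disc can make it large; adding 1
  for \<i> and squaring costs 2 \<eta> S and the constant.\<close>

lemma norm_W_bound:
  assumes \<eta>: "\<eta> > 0" and r: "r > 0" and d: "d > 0"
    and small: "prob {u. 0 < cmod (z - of_real u) \<and> cmod (z - of_real u) < r} \<le> \<eta>"
  shows "(norm (W (z, d)))\<^sup>2 \<le> (atom_mass z + 3 * \<eta> + d\<^sup>2 / r\<^sup>2) * S (z, d) + 2 * (1 / r + 1)\<^sup>2"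
proof -
  let ?q = "(z, d)" and ?N = "{u. 0 < cmod (z - of_real u) \<and> cmod (z - of_real u) < r}"
  let ?Z = "{u. complex_of_real u = z}"
  let ?\<rho> = "\<lambda>u. cmod (z - of_real u)"
  have reg: "regular ?q"
    using d by (intro regular_snd) auto
  note pos = S_pos[OF reg]
  have n2: "(norm (?q - axis_point u))\<^sup>2 = (?\<rho> u)\<^sup>2 + d\<^sup>2" for u
    by (simp only: norm_axis_diff fst_conv snd_conv)
  have n2_pos: "(?\<rho> u)\<^sup>2 + d\<^sup>2 > 0" for u
    using d by (intro add_nonneg_pos) auto
  have int: "integrable \<mu> (\<lambda>u. 1 / ((?\<rho> u)\<^sup>2 + d\<^sup>2))"
    using reg unfolding regular_def n2 by blast
  have S: "S ?q = (\<integral>u. 1 / ((?\<rho> u)\<^sup>2 + d\<^sup>2) \<partial>\<mu>)"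
    unfolding S_def n2 ..
  have int_ind: "integrable \<mu> (\<lambda>u. indicator ?N u :: real)" "integrable \<mu> (\<lambda>u. indicator ?Z u :: real)"
    by (intro integrable_real_indicator sets_annulus sets_atom; simp add: emeasure_eq_measure)+
  have val_ind: "(\<integral>u. indicator ?N u \<partial>\<mu>) = prob ?N" "(\<integral>u. indicator ?Z u \<partial>\<mu>) = atom_mass z"
    by (simp_all add: atom_mass_def space_eq)

  have "d\<^sup>2 * S ?q = (\<integral>u. d\<^sup>2 * (1 / ((?\<rho> u)\<^sup>2 + d\<^sup>2)) \<partial>\<mu>)"
    unfolding S by (rule integral_mult_right_zero[symmetric])
  also have "\<dots> \<le> (\<integral>u. indicator ?Z u + indicator ?N u + d\<^sup>2 / r\<^sup>2 \<partial>\<mu>)"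
  proof (rule integral_mono)
    show "integrable \<mu> (\<lambda>u. d\<^sup>2 * (1 / ((?\<rho> u)\<^sup>2 + d\<^sup>2)))"
      using int by (rule integrable_mult_right)
    show "integrable \<mu> (\<lambda>u. indicator ?Z u + indicator ?N u + d\<^sup>2 / r\<^sup>2)"
      using int_ind by auto
    fix u
    show "d\<^sup>2 * (1 / ((?\<rho> u)\<^sup>2 + d\<^sup>2)) \<le> indicator ?Z u + indicator ?N u + d\<^sup>2 / r\<^sup>2"
    proof (cases "?\<rho> u < r")
      case True
      then have "indicator ?Z u + indicator ?N u = (1::real)"
        by (auto simp: indicator_def)
      moreover have "d\<^sup>2 * (1 / ((?\<rho> u)\<^sup>2 + d\<^sup>2)) \<le> 1"
        using n2_pos[of u] by simp
      moreover have "d\<^sup>2 / r\<^sup>2 \<ge> 0"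
        by simp
      ultimately show ?thesis
        by linarith
    next
      case False
      then have "r\<^sup>2 \<le> (?\<rho> u)\<^sup>2 + d\<^sup>2"
        using r by (intro order_trans[OF power_mono[of r "?\<rho> u" 2]]) auto
      then have "d\<^sup>2 / ((?\<rho> u)\<^sup>2 + d\<^sup>2) \<le> d\<^sup>2 / r\<^sup>2"
        using r n2_pos[of u] by (intro divide_left_mono) auto
      then show ?thesis
        by (simp add: add_nonneg_nonneg order_trans)
    qed
  qed
  also have "\<dots> = atom_mass z + prob ?N + d\<^sup>2 / r\<^sup>2"
    using int_ind val_ind by (simp add: prob_space)
  finally have 1: "d\<^sup>2 * S ?q \<le> atom_mass z + \<eta> + d\<^sup>2 / r\<^sup>2"
    using small by linarith

  \<comment> \<open>Balances the terms t S / 2 and \<eta> / (2 t) of the pointwise estimate below;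
    their sum is then t S = sqrt(\<eta> S).\<close>
  define t where "t = sqrt (\<eta> / S ?q)"
  have t: "t > 0" "t\<^sup>2 * S ?q = \<eta>"
    using \<eta> pos by (simp_all add: t_def)
  have "cmod (fst (V ?q)) \<le> (\<integral>u. cmod (fst (inversion (?q - axis_point u))) \<partial>\<mu>)"
    unfolding V_def integral_bounded_linear[OF bounded_linear_fst integrable_inversion[OF reg], symmetric]
    by (rule integral_norm_bound)
  also have "\<dots> \<le> (\<integral>u. 1 / r + (t / 2 * (1 / ((?\<rho> u)\<^sup>2 + d\<^sup>2)) + 1 / (2 * t) * indicator ?N u) \<partial>\<mu>)"
  proof (rule integral_mono)
    show "integrable \<mu> (\<lambda>u. cmod (fst (inversion (?q - axis_point u))))"
      using integrable_inversion[OF reg] by (intro integrable_norm integrable_bounded_linear[OF bounded_linear_fst])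
    show "integrable \<mu> (\<lambda>u. 1 / r + (t / 2 * (1 / ((?\<rho> u)\<^sup>2 + d\<^sup>2)) + 1 / (2 * t) * indicator ?N u))"
      by (intro Bochner_Integration.integrable_add integrable_mult_right int int_ind integrable_const)
    fix u
    have eq: "cmod (fst (inversion (?q - axis_point u))) = ?\<rho> u / ((?\<rho> u)\<^sup>2 + d\<^sup>2)"
      unfolding inversion_def n2 using n2_pos[of u] by (simp add: divide_inverse mult.commute)
    consider "?\<rho> u = 0" | "0 < ?\<rho> u" "?\<rho> u < r" | "r \<le> ?\<rho> u"
      using norm_ge_zero[of "z - of_real u"] by linarith
    then show "cmod (fst (inversion (?q - axis_point u))) \<le>
        1 / r + (t / 2 * (1 / ((?\<rho> u)\<^sup>2 + d\<^sup>2)) + 1 / (2 * t) * indicator ?N u)"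
      unfolding eq
    proof cases
      case 1
      then show "?\<rho> u / ((?\<rho> u)\<^sup>2 + d\<^sup>2) \<le> 1 / r + (t / 2 * (1 / ((?\<rho> u)\<^sup>2 + d\<^sup>2)) + 1 / (2 * t) * indicator ?N u)"
        using r t by (simp add: add_nonneg_nonneg)
    next
      case 2
      have "0 \<le> (?\<rho> u - t)\<^sup>2 + d\<^sup>2"
        by simp
      then have "2 * t * ?\<rho> u \<le> t\<^sup>2 + ((?\<rho> u)\<^sup>2 + d\<^sup>2)"
        by (simp add: power2_diff mult_ac)
      then have "?\<rho> u \<le> t / 2 + 1 / (2 * t) * ((?\<rho> u)\<^sup>2 + d\<^sup>2)"
        using t by (simp add: field_simps power2_eq_square)
      then have "?\<rho> u / ((?\<rho> u)\<^sup>2 + d\<^sup>2) \<le> (t / 2 + 1 / (2 * t) * ((?\<rho> u)\<^sup>2 + d\<^sup>2)) / ((?\<rho> u)\<^sup>2 + d\<^sup>2)"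
        using n2_pos[of u] by (intro divide_right_mono) auto
      also have "\<dots> = t / 2 * (1 / ((?\<rho> u)\<^sup>2 + d\<^sup>2)) + 1 / (2 * t)"
        by (subst add_divide_distrib) (use d t(1) in simp)
      finally show "?\<rho> u / ((?\<rho> u)\<^sup>2 + d\<^sup>2) \<le> 1 / r + (t / 2 * (1 / ((?\<rho> u)\<^sup>2 + d\<^sup>2)) + 1 / (2 * t) * indicator ?N u)"
        using 2 r by (simp add: add_increasing)
    next
      case 3
      have "r * ?\<rho> u \<le> ?\<rho> u * ?\<rho> u"
        using 3 by (intro mult_right_mono) auto
      also have "\<dots> \<le> (?\<rho> u)\<^sup>2 + d\<^sup>2"
        by (simp add: power2_eq_square)
      finally have "?\<rho> u / ((?\<rho> u)\<^sup>2 + d\<^sup>2) \<le> 1 / r"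
        using n2_pos[of u] r by (simp add: divide_le_eq le_divide_eq mult.commute)
      moreover have "0 \<le> t / 2 * (1 / ((?\<rho> u)\<^sup>2 + d\<^sup>2)) + 1 / (2 * t) * indicator ?N u"
        using t n2_pos[of u] by (intro add_nonneg_nonneg mult_nonneg_nonneg) auto
      ultimately show "?\<rho> u / ((?\<rho> u)\<^sup>2 + d\<^sup>2) \<le> 1 / r + (t / 2 * (1 / ((?\<rho> u)\<^sup>2 + d\<^sup>2)) + 1 / (2 * t) * indicator ?N u)"
        by linarith
    qed
  qed
  also have "\<dots> = 1 / r + (t / 2 * S ?q + 1 / (2 * t) * prob ?N)"
    using Bochner_Integration.integral_add[OF integrable_const[of "1 / r"]
        Bochner_Integration.integrable_add[OF integrable_mult_right[OF int, of "t / 2"]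
          integrable_mult_right[OF int_ind(1), of "1 / (2 * t)"]]]
      Bochner_Integration.integral_add[OF integrable_mult_right[OF int, of "t / 2"]
          integrable_mult_right[OF int_ind(1), of "1 / (2 * t)"]]
    by (simp only: integral_mult_right_zero val_ind S lebesgue_integral_const prob_space scaleR_one)
  also have "1 / (2 * t) * prob ?N \<le> 1 / (2 * t) * (t\<^sup>2 * S ?q)"
    unfolding t(2) using small t(1) by (intro mult_left_mono) auto
  also have "1 / (2 * t) * (t\<^sup>2 * S ?q) = t / 2 * S ?q"
    using t(1) by (simp add: power2_eq_square)
  finally have T: "cmod (fst (V ?q)) \<le> 1 / r + t * S ?q"
    by simp
  have "cmod (fst (V ?q) - \<i>) \<le> cmod (fst (V ?q)) + 1"
    using norm_triangle_ineq4[of "fst (V ?q)" \<i>] by simp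
  also have "\<dots> \<le> t * S ?q + (1 / r + 1)"
    using T by simp
  finally have "(cmod (fst (V ?q) - \<i>))\<^sup>2 \<le> (t * S ?q + (1 / r + 1))\<^sup>2"
    by (rule power_mono) simp
  also have "\<dots> \<le> 2 * (t * S ?q)\<^sup>2 + 2 * (1 / r + 1)\<^sup>2"
    using sum_squares_bound[of "t * S ?q" "1 / r + 1"] unfolding power2_sum[of "t * S ?q" "1 / r + 1"] by linarith
  also have "(t * S ?q)\<^sup>2 = \<eta> * S ?q"
    using t(2) by (simp add: power2_eq_square mult_ac)
  finally have 2: "(cmod (fst (V ?q) - \<i>))\<^sup>2 \<le> 2 * (\<eta> * S ?q) + 2 * (1 / r + 1)\<^sup>2" .
  have "(snd (V ?q))\<^sup>2 = (d\<^sup>2 * S ?q) * S ?q"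
    by (simp add: snd_V[OF reg] power2_eq_square)
  also have "\<dots> \<le> (atom_mass z + \<eta> + d\<^sup>2 / r\<^sup>2) * S ?q"
    using 1 pos by (intro mult_right_mono) auto
  finally have 3: "(snd (V ?q))\<^sup>2 \<le> (atom_mass z + \<eta> + d\<^sup>2 / r\<^sup>2) * S ?q" .
  have "(norm (W ?q))\<^sup>2 = (cmod (fst (V ?q) - \<i>))\<^sup>2 + (snd (V ?q))\<^sup>2"
    by (cases "V ?q") (simp add: W_def norm_Pair)
  also have "\<dots> \<le> (atom_mass z + 3 * \<eta> + d\<^sup>2 / r\<^sup>2) * S ?q + 2 * (1 / r + 1)\<^sup>2"
    using 2 3 by (simp add: algebra_simps)
  finally show ?thesis .
qed

lemma atom_mass_le:
  assumes "d > 0"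
  shows "atom_mass z \<le> d\<^sup>2 * S (z, d)"
proof -
  let ?Z = "{u. complex_of_real u = z}"
  have reg: "regular (z, d)"
    using assms by (intro regular_snd) auto
  have "atom_mass z = (\<integral>u. indicator ?Z u \<partial>\<mu>)"
    by (simp add: atom_mass_def space_eq)
  also have "\<dots> \<le> (\<integral>u. d\<^sup>2 * (1 / (norm ((z, d) - axis_point u))\<^sup>2) \<partial>\<mu>)"
  proof (rule integral_mono)
    show "integrable \<mu> (\<lambda>u. indicator ?Z u :: real)"
      by (auto intro!: integrable_real_indicator simp: emeasure_eq_measure)
    show "integrable \<mu> (\<lambda>u. d\<^sup>2 * (1 / (norm ((z, d) - axis_point u))\<^sup>2))"
      using reg unfolding regular_def by (intro integrable_mult_right) auto
    show "indicator ?Z u \<le> d\<^sup>2 * (1 / (norm ((z, d) - axis_point u))\<^sup>2)" for u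
      using assms by (auto simp: indicator_def norm_axis_diff)
  qed
  also have "\<dots> = d\<^sup>2 * S (z, d)"
    unfolding S_def by (rule integral_mult_right_zero)
  finally show ?thesis .
qed

lemma S_bounded_outside_base:
  assumes "z \<notin> base p" "atom_mass z < p"
  obtains d0 K where "d0 > 0" "\<And>d. 0 < d \<Longrightarrow> d \<le> d0 \<Longrightarrow> S (z, d) \<le> K"
proof -
  \<comment> \<open>The gap between p and the mass is 12 \<eta>: \<open>norm_W_bound\<close> takes 3
    \<eta>, the term d^2 / r^2 takes 3 \<eta> by the choice of \<open>d0\<close>, and the remaining
    6 \<eta> control S.\<close>
  define \<eta> where "\<eta> = (p - atom_mass z) / 12"
  have \<eta>: "\<eta> > 0"
    using assms by (simp add: \<eta>_def)
  from small_annulus[OF \<eta>, of z] obtain r where r: "r > 0"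
    and small: "prob {u. 0 < cmod (z - of_real u) \<and> cmod (z - of_real u) < r} \<le> \<eta>"
    by blast
  define d0 where "d0 = r * sqrt (3 * \<eta>)"
  have d0: "d0 > 0"
    using r \<eta> by (simp add: d0_def)
  show thesis
  proof (rule that[OF d0])
    fix d :: real
    assume d: "0 < d" "d \<le> d0"
    have "d\<^sup>2 \<le> d0\<^sup>2"
      using d by (intro power_mono) auto
    also have "\<dots> = r\<^sup>2 * (3 * \<eta>)"
      using \<eta> by (simp add: d0_def power_mult_distrib)
    finally have dr: "d\<^sup>2 / r\<^sup>2 \<le> 3 * \<eta>"
      using r by (simp add: divide_le_eq mult.commute)
    have reg: "regular (z, d)"
      using d by (intro regular_snd) auto
    note pos = S_pos[OF reg]
    have "p \<le> level (z, d)"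
      using assms(1) d(1) by (rule level_outside_base)
    then have "p * S (z, d) \<le> (norm (W (z, d)))\<^sup>2"
      using pos by (simp add: level_def le_divide_eq)
    also have "\<dots> \<le> (atom_mass z + 3 * \<eta> + d\<^sup>2 / r\<^sup>2) * S (z, d) + 2 * (1 / r + 1)\<^sup>2"
      using \<eta> r d small by (intro norm_W_bound) auto
    also have "(atom_mass z + 3 * \<eta> + d\<^sup>2 / r\<^sup>2) * S (z, d) \<le> (atom_mass z + 6 * \<eta>) * S (z, d)"
      using pos dr by (intro mult_right_mono) auto
    also have "atom_mass z + 6 * \<eta> = p - 6 * \<eta>"
      by (simp add: \<eta>_def field_simps)
    finally have "6 * \<eta> * S (z, d) \<le> 2 * (1 / r + 1)\<^sup>2"
      by (simp add: algebra_simps)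
    then show "S (z, d) \<le> 2 * (1 / r + 1)\<^sup>2 / (6 * \<eta>)"
      using \<eta> by (simp add: le_divide_eq mult_ac)
  qed
qed

text \<open>The inequality p \<le> level holds at every height d > 0 above z. Boundedness of S gives
  integrability at height 0 by monotone convergence, and dominated convergence carries the
  inequality down to d = 0.\<close>

lemma good_outside_base:
  assumes p: "p > 0" and nb: "z \<notin> base p" and mass: "atom_mass z < p"
  shows "good p (z, 0)"
proof -
  obtain d0 K where d0: "d0 > 0" and K: "\<And>d. 0 < d \<Longrightarrow> d \<le> d0 \<Longrightarrow> S (z, d) \<le> K"
    using S_bounded_outside_base[OF nb mass] by blast
  define d where "d = (\<lambda>n. d0 / real (Suc n))"
  have d: "0 < d n" "d n \<le> d0" for n
    using d0 by (auto simp: d_def divide_le_eq)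
  have dec: "d (Suc n) < d n" for n
    using d0 by (simp add: d_def divide_strict_left_mono)
  have lim_d: "d \<longlonglongrightarrow> 0"
    unfolding d_def by (rule LIMSEQ_Suc[OF lim_const_over_n])
  let ?\<rho> = "\<lambda>u. cmod (z - of_real u)"
  have reg: "regular (z, d n)" for n
    using d[of n] by (intro regular_snd) auto
  have n2: "(norm ((z, e) - axis_point u))\<^sup>2 = (?\<rho> u)\<^sup>2 + e\<^sup>2" for e u
    by (simp only: norm_axis_diff fst_conv snd_conv)
  have int: "integrable \<mu> (\<lambda>u. 1 / ((?\<rho> u)\<^sup>2 + (d n)\<^sup>2))" for n
    using reg[of n] unfolding regular_def n2 by blast
  \<comment> \<open>An atom would keep d^2 S(z, d) above its mass while S stays bounded. Hence off
    \<open>base\<close> every atom has mass at least p.\<close>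
  have "atom_mass z \<le> 0"
  proof (rule LIMSEQ_le_const)
    have "(\<lambda>n. (d n)\<^sup>2 * K) \<longlonglongrightarrow> 0\<^sup>2 * K"
      by (intro tendsto_intros lim_d)
    then show "(\<lambda>n. (d n)\<^sup>2 * K) \<longlonglongrightarrow> 0"
      by simp
    have "atom_mass z \<le> (d n)\<^sup>2 * K" for n
      using atom_mass_le[OF d(1)[of n], of z] mult_left_mono[OF K[OF d], of "(d n)\<^sup>2" n]
      by (meson order_trans zero_le_power2)
    then show "\<exists>N. \<forall>n\<ge>N. atom_mass z \<le> (d n)\<^sup>2 * K"
      by blast
  qed
  then have "emeasure \<mu> {u. complex_of_real u = z} = 0"
    using measure_nonneg[of \<mu> "{u. complex_of_real u = z}"]
    by (simp add: atom_mass_def emeasure_eq_measure)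
  then have ne: "AE u in \<mu>. complex_of_real u \<noteq> z"
    by (intro AE_I[of _ _ "{u. complex_of_real u = z}"]) (auto simp: sets_atom)
  have lim_int: "(\<lambda>n. 1 / ((?\<rho> u)\<^sup>2 + (d n)\<^sup>2)) \<longlonglongrightarrow> 1 / (?\<rho> u)\<^sup>2" if "complex_of_real u \<noteq> z" for u
  proof -
    have "(\<lambda>n. 1 / ((?\<rho> u)\<^sup>2 + (d n)\<^sup>2)) \<longlonglongrightarrow> 1 / ((?\<rho> u)\<^sup>2 + 0\<^sup>2)"
      using that by (intro tendsto_divide tendsto_add tendsto_const tendsto_power lim_d) auto
    then show ?thesis
      by simp
  qed
  have "incseq (\<lambda>n. S (z, d n))"
    using S_less[OF d(1) dec] by (intro incseq_SucI) (simp add: less_imp_le)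
  moreover have "S (z, d n) \<le> K" for n
    by (intro K d)
  ultimately obtain L where L: "(\<lambda>n. S (z, d n)) \<longlonglongrightarrow> L"
    using incseq_convergent[of "\<lambda>n. S (z, d n)" K] by blast
  have int0: "integrable \<mu> (\<lambda>u. 1 / (?\<rho> u)\<^sup>2)"
  proof (rule integrable_monotone_convergence[OF int])
    show "AE u in \<mu>. mono (\<lambda>n. 1 / ((?\<rho> u)\<^sup>2 + (d n)\<^sup>2))"
    proof (intro AE_I2 incseq_SucI)
      fix u n
      have "(d (Suc n))\<^sup>2 \<le> (d n)\<^sup>2"
        using dec[of n] d(1)[of "Suc n"] by (intro power_mono) auto
      then show "1 / ((?\<rho> u)\<^sup>2 + (d n)\<^sup>2) \<le> 1 / ((?\<rho> u)\<^sup>2 + (d (Suc n))\<^sup>2)"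
        using d(1)[of n] d(1)[of "Suc n"]
        by (intro divide_left_mono) (auto intro!: mult_pos_pos add_nonneg_pos)
    qed
    show "AE u in \<mu>. (\<lambda>n. 1 / ((?\<rho> u)\<^sup>2 + (d n)\<^sup>2)) \<longlonglongrightarrow> 1 / (?\<rho> u)\<^sup>2"
      using ne by eventually_elim (rule lim_int)
    show "(\<lambda>n. \<integral>u. 1 / ((?\<rho> u)\<^sup>2 + (d n)\<^sup>2) \<partial>\<mu>) \<longlonglongrightarrow> L"
      using L unfolding S_def n2 .
  qed measurable
  have reg0: "regular (z, 0)"
    unfolding regular_def n2 using int0 ne by (auto elim!: eventually_mono)
  have lim_V: "(\<lambda>n. V (z, d n)) \<longlonglongrightarrow> V (z, 0)"
    unfolding V_def
  proof (rule integral_dominated_convergence)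
    have "integrable \<mu> (\<lambda>u. norm (inversion ((z, 0) - axis_point u)))"
      using integrable_inversion[OF reg0] by simp
    then show "integrable \<mu> (\<lambda>u. 1 / norm ((z, 0) - axis_point u))"
      by (simp add: norm_inversion)
    show "AE u in \<mu>. (\<lambda>n. inversion ((z, d n) - axis_point u)) \<longlonglongrightarrow> inversion ((z, 0) - axis_point u)"
      using ne
    proof eventually_elim
      case (elim u)
      then have "(norm ((z, 0) - axis_point u))\<^sup>2 \<noteq> 0"
        unfolding n2 by simp
      then show ?case
        unfolding inversion_def
        by (intro tendsto_scaleR tendsto_inverse tendsto_power tendsto_norm tendsto_diff tendsto_Pair tendsto_const lim_d)
    qed
    show "AE u in \<mu>. norm (inversion ((z, d n) - axis_point u)) \<le> 1 / norm ((z, 0) - axis_point u)" for n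
      using ne
    proof eventually_elim
      case (elim u)
      have "norm ((z, 0) - axis_point u) \<le> norm ((z, d n) - axis_point u)"
        by (rule power2_le_imp_le) (simp_all only: n2 norm_ge_zero, simp)
      moreover have "norm ((z, 0) - axis_point u) > 0"
        using elim by auto
      ultimately show ?case
        unfolding norm_inversion by (intro divide_left_mono mult_pos_pos) auto
    qed
  qed measurable
  have lim_S: "(\<lambda>n. S (z, d n)) \<longlonglongrightarrow> S (z, 0)"
    unfolding S_def n2
  proof (rule integral_dominated_convergence)
    show "integrable \<mu> (\<lambda>u. 1 / (?\<rho> u)\<^sup>2)"
      by (rule int0)
    show "AE u in \<mu>. (\<lambda>n. 1 / ((?\<rho> u)\<^sup>2 + (d n)\<^sup>2)) \<longlonglongrightarrow> 1 / ((?\<rho> u)\<^sup>2 + 0\<^sup>2)"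
      using ne by eventually_elim (simp add: lim_int)
    show "AE u in \<mu>. norm (1 / ((?\<rho> u)\<^sup>2 + (d n)\<^sup>2)) \<le> 1 / (?\<rho> u)\<^sup>2" for n
      using ne
    proof eventually_elim
      case (elim u)
      then have "(?\<rho> u)\<^sup>2 > 0"
        by simp
      then show ?case
        by (auto intro!: divide_left_mono mult_pos_pos add_pos_nonneg)
    qed
  qed measurable
  have "p * S (z, 0) \<le> (norm (W (z, 0)))\<^sup>2"
  proof (rule LIMSEQ_le)
    show "(\<lambda>n. p * S (z, d n)) \<longlonglongrightarrow> p * S (z, 0)"
      by (intro tendsto_intros lim_S)
    show "(\<lambda>n. (norm (W (z, d n)))\<^sup>2) \<longlonglongrightarrow> (norm (W (z, 0)))\<^sup>2"
      unfolding W_def by (intro tendsto_power tendsto_norm tendsto_diff tendsto_const lim_V)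
    have "p * S (z, d n) \<le> (norm (W (z, d n)))\<^sup>2" for n
    proof -
      have "p \<le> level (z, d n)"
        using nb d(1) by (rule level_outside_base)
      then show ?thesis
        using S_pos[OF reg[of n]] by (simp add: level_def le_divide_eq)
    qed
    then show "\<exists>N. \<forall>n\<ge>N. p * S (z, d n) \<le> (norm (W (z, d n)))\<^sup>2"
      by blast
  qed
  moreover have "p * S (z, 0) > 0"
    using p S_pos[OF reg0] by simp
  ultimately show ?thesis
    using reg0 by (auto simp: good_def)
qed

end

section \<open>The boundary map is a homeomorphism\<close>

text \<open>Preimages of a convergent sequence stay bounded because f moves far points by at most C,
  so the range is closed. By invariance of domain it is also open, hence the whole space by
  connectedness.\<close>

lemma bounded_perturbation_homeomorphism:
  fixes f :: "'a::euclidean_space \<Rightarrow> 'a"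
  assumes cont: "continuous_on UNIV f" and inj: "inj f"
    and bound: "\<And>z. norm z \<ge> r \<Longrightarrow> norm (f z - z) \<le> C"
  shows "\<exists>g. homeomorphism UNIV UNIV f g"
proof -
  have "closed (range f)"
    unfolding closed_sequential_limits
  proof (intro allI impI, elim conjE)
    fix Y l
    assume "\<forall>n. Y n \<in> range f" and lim: "Y \<longlonglongrightarrow> l"
    then have "\<forall>n. \<exists>x. Y n = f x"
      by blast
    then obtain X where X: "\<And>n. Y n = f (X n)"
      by metis
    from lim have "bounded (range Y)"
      by (rule convergent_imp_bounded)
    then obtain B where B: "\<And>n. norm (Y n) \<le> B"
      unfolding bounded_iff by blast
    have "norm (X n) \<le> \<bar>r\<bar> + \<bar>B\<bar> + \<bar>C\<bar>" for n
    proof (cases "norm (X n) \<ge> r")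
      case True
      from bound[OF this] B[of n] show ?thesis
        using norm_triangle_sub[of "X n" "f (X n)"] by (simp add: X norm_minus_commute)
    qed auto
    then have "bounded (range X)"
      unfolding bounded_iff by blast
    then obtain x s where s: "strict_mono s" and x: "(X \<circ> s) \<longlonglongrightarrow> x"
      using bounded_imp_convergent_subsequence by blast
    have "(\<lambda>n. f ((X \<circ> s) n)) \<longlonglongrightarrow> f x"
      by (rule continuous_on_tendsto_compose[OF cont x]) auto
    moreover have "(\<lambda>n. f ((X \<circ> s) n)) \<longlonglongrightarrow> l"
      using LIMSEQ_subseq_LIMSEQ[OF lim s] by (simp add: o_def X)
    ultimately show "l \<in> range f"
      using LIMSEQ_unique by blast
  qed
  moreover have "open (range f)"
    using cont inj by (intro invariance_of_domain) auto
  ultimately have "range f = UNIV"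
    using clopen[of "range f"] by auto
  then show ?thesis
    using invariance_of_domain_homeomorphism[OF open_UNIV cont _ inj] by auto
qed

context bounded_distribution begin

text \<open>The second branch is reached only at real atoms of mass at least p off
  \<open>base\<close> (see \<open>not_good_height\<close>). Splitting by \<open>good\<close> rather
  than by atoms matches the estimates.\<close>

definition hmap :: "real \<Rightarrow> complex \<Rightarrow> complex" where
  "hmap p z = (if good p (z, height p z) then fst (subord p (z, height p z)) else z)"

section \<open>The map on the graph of the height function\<close>

lemma good_base:
  assumes "p > 0" "z \<in> base p"
  shows "good p (z, height p z)" and "(norm (W (z, height p z)))\<^sup>2 = p * S (z, height p z)"
proof -
  have reg: "regular (z, height p z)"
    using height_base(1)[OF assms(2)] by (intro regular_snd) auto
  show eq: "(norm (W (z, height p z)))\<^sup>2 = p * S (z, height p z)"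
    using height_base(2)[OF assms(2)] S_pos[OF reg] by (simp add: level_def divide_eq_eq)
  moreover have "p * S (z, height p z) > 0"
    using assms(1) S_pos[OF reg] by simp
  ultimately show "good p (z, height p z)"
    using reg by (auto simp: good_def)
qed

text \<open>The second coordinate is the height times 1 - p S / |W|^2. On \<open>base\<close> the
  latter factor vanishes, because the level is p there; off \<open>base\<close> the height
  vanishes.\<close>

lemma subord_height:
  assumes "p > 0" "good p (z, height p z)"
  shows "subord p (z, height p z) = (hmap p z, 0)"
proof -
  let ?q = "(z, height p z)"
  have reg: "regular ?q" and W: "W ?q \<noteq> 0"
    using assms by (auto simp: good_def)
  have snd: "snd (subord p ?q) = height p z - p * (height p z * S ?q / (norm (W ?q))\<^sup>2)"
    using snd_V[OF reg] by (simp add: subord_def inversion_def W_def divide_inverse mult_ac)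
  have "snd (subord p ?q) = 0"
  proof (cases "z \<in> base p")
    case True
    then show ?thesis
      unfolding snd good_base(2)[OF assms(1) True] using assms(1) S_pos[OF reg] by simp
  next
    case False
    then show ?thesis
      unfolding snd by (simp add: height_def)
  qed
  then show ?thesis
    using assms by (simp add: hmap_def prod_eq_iff)
qed

lemma not_good_height:
  assumes "p > 0" "\<not> good p (z, height p z)"
  obtains u where "z = complex_of_real u" "p \<le> prob {u}" "height p z = 0" "hmap p z = z"
proof -
  have nb: "z \<notin> base p"
    using good_base(1)[OF assms(1)] assms(2) by blast
  then have height: "height p z = 0"
    by (simp add: height_def)
  with assms nb have mass: "p \<le> atom_mass z"
    using good_outside_base[of p z] by force
  have "{u. complex_of_real u = z} \<noteq> {}"
  proof
    assume "{u. complex_of_real u = z} = {}"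
    with mass assms(1) show False
      by (simp add: atom_mass_def)
  qed
  then obtain u where u: "z = complex_of_real u"
    by auto
  then have "p \<le> prob {u}"
    using mass by (simp add: atom_mass_def)
  with u height assms(2) show thesis
    using that by (simp add: hmap_def)
qed

text \<open>Stands in for the contraction when the other point is a heavy atom. The atom contributes
  at least p / |q - v|^2 to S(q), and the rest of \<mu> contributes something positive, so |W q|^2
  \<ge> p S(q) > p^2 / |q - v|^2.\<close>

lemma norm_inversion_W_less:
  assumes np: "\<not> point_mass \<mu>" and p: "p > 0" and good: "good p q" and mass: "p \<le> prob {v}"
  shows "norm (p *\<^sub>R inversion (W q)) < norm (q - axis_point v)"
proof -
  let ?n = "\<lambda>u. norm (q - axis_point u)"
  have reg: "regular q" and W: "norm (W q) > 0" and le: "p * S q \<le> (norm (W q))\<^sup>2"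
    using good by (auto simp: good_def)
  have int: "integrable \<mu> (\<lambda>u. 1 / (?n u)\<^sup>2)" and ne: "AE u in \<mu>. q \<noteq> axis_point u"
    using reg by (auto simp: regular_def)
  have v: "{v} \<in> sets \<mu>"
    by (simp add: sets_eq)
  have qv: "q \<noteq> axis_point v"
  proof
    assume "q = axis_point v"
    with ne have "AE u in \<mu>. u \<notin> {v}"
      by (auto elim: eventually_mono)
    then have "prob {v} = 0"
      using v by (subst (asm) prob_eq_0[symmetric]) auto
    with mass p show False by simp
  qed
  then have nv: "?n v > 0"
    by simp
  let ?f = "\<lambda>u. 1 / (?n u)\<^sup>2 - 1 / (?n v)\<^sup>2 * indicator {v} u"
  have int_ind: "integrable \<mu> (\<lambda>u. 1 / (?n v)\<^sup>2 * indicator {v} u)"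
    using v by (intro integrable_mult_right integrable_real_indicator) (auto simp: emeasure_eq_measure)
  have int_f: "integrable \<mu> ?f"
    using int int_ind by (rule Bochner_Integration.integrable_diff)
  have f_nonneg: "?f u \<ge> 0" for u
    by (auto simp: indicator_def)
  have "integral\<^sup>L \<mu> ?f \<noteq> 0"
  proof
    assume "integral\<^sup>L \<mu> ?f = 0"
    then have "AE u in \<mu>. ?f u = 0"
      using integral_nonneg_eq_0_iff_AE[OF int_f] f_nonneg by blast
    with ne have "AE u in \<mu>. u \<in> {v}"
    proof eventually_elim
      case (elim u)
      then show ?case
        by (cases "u = v") auto
    qed
    then have "prob {v} = 1"
      using v by (subst (asm) AE_in_set_eq_1) auto
    with np show False
      by (auto simp: point_mass_def)
  qed
  moreover have "integral\<^sup>L \<mu> ?f \<ge> 0"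
    using f_nonneg by (intro integral_nonneg_AE) auto
  moreover have "integral\<^sup>L \<mu> ?f = S q - 1 / (?n v)\<^sup>2 * prob {v}"
    unfolding S_def Bochner_Integration.integral_diff[OF int int_ind] integral_mult_right_zero
    by (simp add: space_eq)
  ultimately have "prob {v} / (?n v)\<^sup>2 < S q"
    by simp
  then have "p * (prob {v} / (?n v)\<^sup>2) < p * S q"
    using p by (rule mult_strict_left_mono)
  moreover have "p * (p / (?n v)\<^sup>2) \<le> p * (prob {v} / (?n v)\<^sup>2)"
    using p mass by (intro mult_left_mono divide_right_mono) auto
  ultimately have "(p / ?n v)\<^sup>2 < (norm (W q))\<^sup>2"
    using le by (simp add: power2_eq_square)
  then have "p / ?n v < norm (W q)"
    using W power2_less_imp_less by (metis less_imp_le)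
  then have "p / norm (W q) < ?n v"
    using W nv by (simp add: divide_less_eq mult.commute)
  then show ?thesis
    using p by (simp add: norm_inversion)
qed

text \<open>From q - v a strictly shorter vector is subtracted. So leaving v fixed is compatible
  both with the Lipschitz bound and with injectivity.\<close>

lemma norm_subord_axis:
  assumes "\<not> point_mass \<mu>" "p > 0" "good p q" "p \<le> prob {v}"
  shows "norm (subord p q - axis_point v) \<le> 2 * norm (q - axis_point v)"
    and "subord p q \<noteq> axis_point v"
proof -
  have eq: "subord p q - axis_point v = (q - axis_point v) - p *\<^sub>R inversion (W q)"
    by (simp add: subord_def)
  show "norm (subord p q - axis_point v) \<le> 2 * norm (q - axis_point v)"
    unfolding eq using norm_inversion_W_less[OF assms] norm_triangle_ineq4[of "q - axis_point v" "p *\<^sub>R inversion (W q)"]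
    by linarith
  show "subord p q \<noteq> axis_point v"
  proof
    assume "subord p q = axis_point v"
    then have "q - axis_point v = p *\<^sub>R inversion (W q)"
      using eq by simp
    then show False
      using norm_inversion_W_less[OF assms] by simp
  qed
qed

text \<open>The distance is taken between points of the graph, so that continuity of the height
  alone makes \<open>hmap\<close> continuous.\<close>

lemma hmap_lipschitz:
  assumes np: "\<not> point_mass \<mu>" and p: "p > 0"
  shows "cmod (hmap p z - hmap p z') \<le> 2 * norm ((z, height p z) - (z', height p z'))"
proof -
  let ?q = "\<lambda>z. (z, height p z)"
  have mixed: "cmod (hmap p z - hmap p z') \<le> 2 * norm (?q z - ?q z')"
    if "good p (?q z)" "\<not> good p (?q z')" for z z'
  proof -
    obtain v where v: "z' = complex_of_real v" "p \<le> prob {v}" "height p z' = 0" "hmap p z' = z'"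
      using not_good_height[OF p \<open>\<not> good p (?q z')\<close>] by blast
    have "cmod (hmap p z - hmap p z') = norm ((hmap p z, 0::real) - axis_point v)"
      using v by (simp add: norm_Pair)
    also have "(hmap p z, 0) = subord p (?q z)"
      using subord_height[OF p that(1)] by simp
    also have "norm (subord p (?q z) - axis_point v) \<le> 2 * norm (?q z - axis_point v)"
      using np p that(1) v(2) by (rule norm_subord_axis)
    finally show ?thesis
      using v by simp
  qed
  consider "good p (?q z)" "good p (?q z')" | "good p (?q z)" "\<not> good p (?q z')"
    | "\<not> good p (?q z)" "good p (?q z')" | "\<not> good p (?q z)" "\<not> good p (?q z')"
    by blast
  then show ?thesis
  proof cases
    case 1
    have "cmod (hmap p z - hmap p z') = norm ((hmap p z, 0::real) - (hmap p z', 0))"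
      by (simp add: norm_Pair)
    also have "\<dots> = norm (subord p (?q z) - subord p (?q z'))"
      using subord_height[OF p] 1 by simp
    also have "\<dots> \<le> 2 * norm (?q z - ?q z')"
      using p 1 by (rule subord_lipschitz)
    finally show ?thesis .
  next
    case 2
    then show ?thesis by (rule mixed)
  next
    case 3
    then show ?thesis
      using mixed[of z' z] by (metis norm_minus_commute)
  next
    case 4
    obtain u v where "z = complex_of_real u" "height p z = 0" "hmap p z = z"
      "z' = complex_of_real v" "height p z' = 0" "hmap p z' = z'"
      using not_good_height[OF p 4(1)] not_good_height[OF p 4(2)] by metis
    then show ?thesis
      by (simp add: norm_Pair)
  qed
qed

lemma continuous_on_hmap:
  assumes "\<not> point_mass \<mu>" "p > 0"
  shows "continuous_on UNIV (hmap p)"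
  unfolding continuous_on_def
proof
  fix z
  have "((\<lambda>x. (x, height p x)) \<longlongrightarrow> (z, height p z)) (at z)"
    using continuous_on_height[of p] by (intro tendsto_Pair tendsto_ident_at) (simp add: continuous_on_def)
  then have "((\<lambda>x. 2 * norm ((x, height p x) - (z, height p z))) \<longlongrightarrow> 2 * norm ((z, height p z) - (z, height p z))) (at z)"
    by (intro tendsto_mult tendsto_const tendsto_norm tendsto_diff)
  then have "((\<lambda>x. 2 * norm ((x, height p x) - (z, height p z))) \<longlongrightarrow> 0) (at z)"
    by simp
  then have "((\<lambda>x. hmap p x - hmap p z) \<longlongrightarrow> 0) (at z)"
    by (rule Lim_null_comparison[rotated]) (use hmap_lipschitz[OF assms] in auto)
  then show "(hmap p \<longlongrightarrow> hmap p z) (at z within UNIV)"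
    by (simp add: LIM_zero_iff)
qed

lemma inj_hmap:
  assumes np: "\<not> point_mass \<mu>" and p: "p > 0"
  shows "inj (hmap p)"
proof (rule injI)
  let ?q = "\<lambda>z. (z, height p z)"
  fix z z'
  assume eq: "hmap p z = hmap p z'"
  have mixed: "hmap p z \<noteq> hmap p z'" if "good p (?q z)" "\<not> good p (?q z')" for z z'
  proof -
    obtain v where v: "z' = complex_of_real v" "p \<le> prob {v}" "hmap p z' = z'"
      using not_good_height[OF p \<open>\<not> good p (?q z')\<close>] by blast
    have "subord p (?q z) \<noteq> axis_point v"
      using np p that(1) v(2) by (rule norm_subord_axis)
    then show ?thesis
      using subord_height[OF p that(1)] v by auto
  qed
  consider "good p (?q z)" "good p (?q z')" | "\<not> good p (?q z)" "\<not> good p (?q z')"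
    using mixed[of z z'] mixed[of z' z] eq by auto
  then show "z = z'"
  proof cases
    case 1
    then have "subord p (?q z) = subord p (?q z')"
      using subord_height[OF p] eq by simp
    from subord_inj[OF np p 1 _ _ this] have "?q z = ?q z'"
      by (simp add: height_nonneg)
    then show ?thesis by simp
  next
    case 2
    then show ?thesis
      using eq by (simp add: hmap_def)
  qed
qed

text \<open>For these z almost every u satisfies |z - u| \<ge> 2, so |V| \<le> 1/2 at any height. As
  (\<i>, 0) has norm 1, |W| \<ge> 1/2, and the subtracted term has norm p / |W|.\<close>

lemma hmap_bounded_perturbation:
  assumes p: "p > 0" and z: "cmod z \<ge> R + 2"
  shows "cmod (hmap p z - z) \<le> 2 * p"
proof (cases "good p (z, height p z)")
  case True
  let ?q = "(z, height p z)"
  have reg: "regular ?q"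
    using True by (simp add: good_def)
  have "norm (V ?q) \<le> (\<integral>u. norm (inversion (?q - axis_point u)) \<partial>\<mu>)"
    unfolding V_def by (rule integral_norm_bound)
  also have "\<dots> \<le> (\<integral>u. 1 / 2 \<partial>\<mu>)"
  proof (rule integral_mono_AE)
    show "integrable \<mu> (\<lambda>u. norm (inversion (?q - axis_point u)))"
      using integrable_inversion[OF reg] by simp
    show "AE u in \<mu>. norm (inversion (?q - axis_point u)) \<le> 1 / 2"
      using AE_bounded
    proof eventually_elim
      case (elim u)
      have "cmod z - cmod (of_real u) \<le> cmod (z - of_real u)"
        by (rule norm_triangle_ineq2)
      with elim z have "2 \<le> cmod (z - of_real u)"
        by simp
      also have "\<dots> \<le> norm (?q - axis_point u)"
        by (rule power2_le_imp_le) (simp_all only: norm_axis_diff fst_conv snd_conv norm_ge_zero, simp)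
      finally have "2 \<le> norm (?q - axis_point u)" .
      then show ?case
        unfolding norm_inversion by (intro divide_left_mono) auto
    qed
  qed simp
  finally have "norm (V ?q) \<le> 1 / 2"
    by (simp add: prob_space)
  moreover have "norm (\<i>, 0::real) \<le> norm (V ?q) + norm (W ?q)"
    unfolding W_def using norm_triangle_sub[of "(\<i>, 0::real)" "V ?q"] by (simp add: norm_minus_commute)
  ultimately have W: "1 / 2 \<le> norm (W ?q)"
    by (simp add: norm_Pair)
  have fst_le: "cmod (fst w) \<le> norm w" for w :: "complex \<times> real"
    using norm_fst_le[of "fst w" "snd w"] by simp
  have "hmap p z - z = - fst (p *\<^sub>R inversion (W ?q))"
    using True by (simp add: hmap_def subord_def)
  then have "cmod (hmap p z - z) \<le> norm (p *\<^sub>R inversion (W ?q))"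
    by (simp only: norm_minus_cancel fst_le)
  also have "\<dots> = p / norm (W ?q)"
    using p by (simp add: norm_inversion)
  also have "\<dots> \<le> p / (1 / 2)"
    using W p by (intro divide_left_mono) auto
  finally show ?thesis
    by simp
next
  case False
  then show ?thesis
    using p by (simp add: hmap_def)
qed

lemma hmap_homeomorphism:
  assumes "\<not> point_mass \<mu>" "p > 0"
  shows "\<exists>g. homeomorphism UNIV UNIV (hmap p) g"
  using continuous_on_hmap[OF assms] inj_hmap[OF assms] hmap_bounded_perturbation[OF assms(2)]
  by (rule bounded_perturbation_homeomorphism)

end

section \<open>Resolvents of selfadjoint elements\<close>

lemma scaleC_one [simp]: "1 *\<^sub>C (a::'a::cstar_algebra) = a"
  using scaleR_conv_scaleC[of 1 a] by simp

lemma scaleC_zero_left [simp]: "0 *\<^sub>C (a::'a::cstar_algebra) = 0"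
  using scaleR_conv_scaleC[of 0 a] by simp

lemma scaleC_minus_left: "(- c) *\<^sub>C (a::'a::cstar_algebra) = - (c *\<^sub>C a)"
  using scaleC_add_left[of "- c" c a] by (simp add: add_eq_0_iff2)

lemma scaleC_minus_right: "c *\<^sub>C (- a::'a::cstar_algebra) = - (c *\<^sub>C a)"
  using scaleC_add_right[of c "- a" a] scaleC_scaleC[of c 0 a] by (simp add: add_eq_0_iff2)

lemma scaleC_diff_left: "(c - d) *\<^sub>C (a::'a::cstar_algebra) = c *\<^sub>C a - d *\<^sub>C a"
  using scaleC_add_left[of c "- d" a] by (simp add: scaleC_minus_left)

lemma scaleC_diff_right: "c *\<^sub>C (a - b::'a::cstar_algebra) = c *\<^sub>C a - c *\<^sub>C b"
  using scaleC_add_right[of c a "- b"] by (simp add: scaleC_minus_right)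

lemma scaleC_power: "(c *\<^sub>C (a::'a::cstar_algebra)) ^ n = (c ^ n) *\<^sub>C (a ^ n)"
  by (induction n) (simp_all add: mult_scaleC_left mult_scaleC_right scaleC_scaleC mult.commute)

lemmas scaleC_simps = scaleC_add_left scaleC_add_right scaleC_diff_left scaleC_diff_right
  scaleC_minus_left scaleC_minus_right scaleC_scaleC mult_scaleC_left mult_scaleC_right

lemma adj_one [simp]: "adj (1::'a::cstar_algebra) = 1"
proof -
  have "adj (adj (1::'a) * 1) = adj 1 * 1"
    by (simp only: adj_mult adj_adj)
  then show ?thesis
    by (simp add: adj_adj)
qed

lemma adj_minus: "adj (- a::'a::cstar_algebra) = - adj a"
  using adj_scaleC[of "-1" a] by (simp add: scaleC_minus_left)

lemma adj_diff: "adj (a - b::'a::cstar_algebra) = adj a - adj b"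
  using adj_add[of a "- b"] by (simp add: adj_minus)

text \<open>Arens' trick: shifting a selfadjoint element in the imaginary direction increases the norm
  only quadratically, so resolvents at non-real points are Neumann series around a far point.\<close>

lemma norm_selfadjoint_shift:
  fixes x :: "'a::cstar_algebra"
  assumes "selfadjoint x"
  shows "(norm (x - w *\<^sub>C 1))\<^sup>2 \<le> (norm (x - of_real (Re w) *\<^sub>C 1))\<^sup>2 + (Im w)\<^sup>2"
proof -
  define y where "y = x - of_real (Re w) *\<^sub>C 1"
  define c where "c = \<i> * of_real (Im w)"
  have c: "cnj c = - c" "c * c = - of_real ((Im w)\<^sup>2)"
    by (simp_all add: c_def power2_eq_square complex_eq_iff)
  have y: "adj y = y"
    using assms by (simp add: y_def selfadjoint_def adj_diff adj_scaleC)
  have w: "w = of_real (Re w) + c"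
    unfolding c_def by (rule complex_eq)
  have x: "x - w *\<^sub>C 1 = y - c *\<^sub>C 1"
    by (subst w) (simp add: y_def scaleC_add_left)
  have "adj (y - c *\<^sub>C 1) * (y - c *\<^sub>C 1) = (y + c *\<^sub>C 1) * (y - c *\<^sub>C 1)"
    by (simp add: adj_diff adj_scaleC y c scaleC_minus_left)
  also have "\<dots> = y * y + of_real ((Im w)\<^sup>2) *\<^sub>C 1"
    by (simp add: distrib_right right_diff_distrib scaleC_simps c(2))
  finally have "(norm (y - c *\<^sub>C 1))\<^sup>2 = norm (y * y + of_real ((Im w)\<^sup>2) *\<^sub>C 1)"
    by (metis cstar_identity)
  also have "\<dots> \<le> norm (y * y) + norm ((of_real ((Im w)\<^sup>2) :: complex) *\<^sub>C (1::'a))"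
    by (rule norm_triangle_ineq)
  also have "norm ((of_real ((Im w)\<^sup>2) :: complex) *\<^sub>C (1::'a)) = (Im w)\<^sup>2"
    by (simp only: norm_scaleC norm_of_real) simp
  also have "norm (y * y) \<le> (norm y)\<^sup>2"
    by (simp add: power2_eq_square norm_mult_ineq)
  finally show ?thesis
    by (simp add: x y_def)
qed

lemma neumann_series:
  fixes e :: "'a::{real_normed_algebra_1, banach}"
  assumes "norm e < 1"
  shows "(1 - e) * (\<Sum>n. e ^ n) = 1" "(\<Sum>n. e ^ n) * (1 - e) = 1"
proof -
  have s: "(\<lambda>n. e ^ n) sums (\<Sum>n. e ^ n)"
    using complete_algebra_summable_geometric[OF assms] by (rule summable_sums)
  then have shift: "(\<lambda>n. e ^ Suc n) sums ((\<Sum>n. e ^ n) - 1)"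
    by (subst sums_Suc_iff) simp
  have "(\<lambda>n. e * e ^ n) sums (e * (\<Sum>n. e ^ n))" "(\<lambda>n. e ^ n * e) sums ((\<Sum>n. e ^ n) * e)"
    using s by (auto intro: sums_mult sums_mult2)
  then have "e * (\<Sum>n. e ^ n) = (\<Sum>n. e ^ n) - 1" "(\<Sum>n. e ^ n) * e = (\<Sum>n. e ^ n) - 1"
    using shift by (auto intro!: sums_unique2 simp: power_commutes)
  then show "(1 - e) * (\<Sum>n. e ^ n) = 1" "(\<Sum>n. e ^ n) * (1 - e) = 1"
    by (simp_all add: left_diff_distrib right_diff_distrib)
qed

section \<open>From moments to Cauchy transforms\<close>

locale distribution_functional = bounded_distribution \<mu> R
  for \<mu> :: "real measure" and R +
  fixes \<phi> :: "'a::cstar_algebra \<Rightarrow> complex" and x :: 'a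
  assumes bounded_linear: "bounded_linear \<phi>"
    and complex_linear: "\<phi> (c *\<^sub>C a) = c * \<phi> a"
    and selfadjoint: "selfadjoint x"
    and moments: "\<phi> (x ^ n) = of_real (\<integral>u. u ^ n \<partial>\<mu>)"
begin

lemma \<phi>_diff: "\<phi> (a - b) = \<phi> a - \<phi> b"
  using bounded_linear by (simp add: linear_simps)

lemma measurable_of_real [measurable]: "complex_of_real \<in> borel_measurable \<mu>"
  unfolding measurable_cong_sets[OF sets_eq refl]
  by (intro borel_measurable_continuous_onI continuous_intros)

lemma integrable_polynomial: "integrable \<mu> (\<lambda>u. complex_of_real u ^ m * (of_real u - w) ^ n)"
proof (rule integrable_const_bound)
  show "AE u in \<mu>. norm (complex_of_real u ^ m * (of_real u - w) ^ n) \<le> R ^ m * (R + norm w) ^ n"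
    using AE_bounded
  proof eventually_elim
    case (elim u)
    have "norm (complex_of_real u - w) \<le> R + norm w"
      using norm_triangle_ineq4[of "complex_of_real u" w] elim by simp
    then show ?case
      using elim unfolding norm_mult norm_power by (intro mult_mono power_mono) auto
  qed
qed measurable

text \<open>Splitting off one factor x - w raises m in one of the two resulting terms, so the
  induction on n keeps m arbitrary.\<close>

lemma shifted_moments: "\<phi> (x ^ m * (x - w *\<^sub>C 1) ^ n) = (\<integral>u. of_real u ^ m * (of_real u - w) ^ n \<partial>\<mu>)"
proof (induction n arbitrary: m)
  case 0
  then show ?case
    by (simp add: moments flip: of_real_power)
next
  case (Suc n)
  let ?y = "x - w *\<^sub>C 1"
  have "x * ?y ^ n = ?y ^ n * x"
    by (rule power_commuting_commutes[symmetric]) (simp add: left_diff_distrib right_diff_distrib scaleC_simps)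
  then have "x ^ m * ?y ^ Suc n = x ^ Suc m * ?y ^ n - w *\<^sub>C (x ^ m * ?y ^ n)"
    unfolding power_Suc2[of ?y] power_Suc2[of x]
    by (simp add: right_diff_distrib scaleC_simps mult.assoc)
  then have "\<phi> (x ^ m * ?y ^ Suc n) = \<phi> (x ^ Suc m * ?y ^ n) - w * \<phi> (x ^ m * ?y ^ n)"
    by (simp only: \<phi>_diff complex_linear)
  also have "\<dots> = (\<integral>u. of_real u ^ Suc m * (of_real u - w) ^ n - w * (of_real u ^ m * (of_real u - w) ^ n) \<partial>\<mu>)"
    unfolding Suc.IH
      Bochner_Integration.integral_diff[OF integrable_polynomial integrable_mult_right[OF integrable_polynomial]]
      integral_mult_right_zero ..
  also have "\<dots> = (\<integral>u. of_real u ^ m * (of_real u - w) ^ Suc n \<partial>\<mu>)"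
    by (rule Bochner_Integration.integral_cong) (simp_all add: algebra_simps)
  finally show ?case .
qed

text \<open>The Neumann series of the resolvent around w and the geometric series of 1 / (z - u)
  have the shifted moments as common terms, once \<phi> and the integral act termwise. Each series
  gets its own convergence condition, since R and the norm of x are not compared.\<close>

lemma resolvent_near:
  assumes x: "norm (x - w *\<^sub>C 1) < cmod (z - w)" and \<rho>: "\<rho> < cmod (z - w)"
    and AE: "AE u in \<mu>. cmod (of_real u - w) \<le> \<rho>"
  obtains r where "(z *\<^sub>C 1 - x) * r = 1" "r * (z *\<^sub>C 1 - x) = 1" "\<phi> r = (\<integral>u. 1 / (z - of_real u) \<partial>\<mu>)"
proof -
  define c where "c = 1 / (z - w)"
  define e where "e = c *\<^sub>C (x - w *\<^sub>C 1)"
  define N where "N = (\<Sum>n. e ^ n)"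
  have zw: "cmod (z - w) > 0"
    using x norm_ge_zero[of "x - w *\<^sub>C 1"] by linarith
  then have c: "c * (z - w) = 1" "(z - w) * c = 1"
    by (auto simp: c_def)
  have e: "norm e < 1"
    using x zw by (simp add: e_def c_def norm_scaleC norm_divide divide_less_eq)
  have zx: "z *\<^sub>C 1 - x = (z - w) *\<^sub>C (1 - e)"
    unfolding e_def scaleC_diff_right[of _ 1] scaleC_scaleC c scaleC_one scaleC_diff_left by simp
  note N = neumann_series[OF e, folded N_def]
  have \<phi>_e: "\<phi> (e ^ n) = c ^ n * (\<integral>u. (of_real u - w) ^ n \<partial>\<mu>)" for n
    using shifted_moments[of 0 w n] by (simp add: e_def scaleC_power complex_linear)
  let ?f = "\<lambda>n u. c * (c ^ n * (of_real u - w) ^ n)"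
  define \<theta> where "\<theta> = \<rho> / cmod (z - w)"
  have "AE u in \<mu>. 0 \<le> \<rho>"
    using AE by eventually_elim (meson norm_ge_zero order_trans)
  then have "0 \<le> \<rho>"
    by (simp add: AE_const)
  with \<rho> zw have \<theta>: "0 \<le> \<theta>" "\<theta> < 1"
    by (simp_all add: \<theta>_def divide_less_eq)
  have norm_c: "cmod (c * (of_real u - w)) \<le> \<theta>" if "cmod (of_real u - w) \<le> \<rho>" for u
    using that zw by (simp add: c_def \<theta>_def norm_mult norm_divide divide_right_mono)
  have norm_f: "norm (?f n u) \<le> cmod c * \<theta> ^ n" if "cmod (of_real u - w) \<le> \<rho>" for n u
    using norm_c[OF that] unfolding power_mult_distrib[symmetric] norm_mult[of c] norm_power
    by (intro mult_left_mono power_mono) auto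
  have int: "integrable \<mu> (?f n)" for n
    using integrable_polynomial[of 0 w n] by (intro integrable_mult_right) simp
  have summ: "summable (\<lambda>n. cmod c * \<theta> ^ n)"
    using \<theta> by (intro summable_mult summable_geometric) auto
  have "(\<lambda>n. integral\<^sup>L \<mu> (?f n)) sums (\<integral>u. (\<Sum>n. ?f n u) \<partial>\<mu>)"
  proof (rule sums_integral[OF int])
    show "AE u in \<mu>. summable (\<lambda>n. norm (?f n u))"
      using AE
    proof eventually_elim
      case (elim u)
      show ?case
        by (rule summable_comparison_test'[OF summ]) (use norm_f[OF elim] in auto)
    qed
    show "summable (\<lambda>n. \<integral>u. norm (?f n u) \<partial>\<mu>)"
    proof (rule summable_comparison_test'[OF summ])
      fix n
      have "(\<integral>u. norm (?f n u) \<partial>\<mu>) \<le> (\<integral>u. cmod c * \<theta> ^ n \<partial>\<mu>)"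
      proof (rule integral_mono_AE)
        show "AE u in \<mu>. norm (?f n u) \<le> cmod c * \<theta> ^ n"
          using AE by eventually_elim (rule norm_f)
      qed (use int in auto)
      then show "norm (\<integral>u. norm (?f n u) \<partial>\<mu>) \<le> cmod c * \<theta> ^ n"
        by (simp add: prob_space integral_nonneg_AE)
    qed
  qed
  moreover have "(\<integral>u. (\<Sum>n. ?f n u) \<partial>\<mu>) = (\<integral>u. 1 / (z - of_real u) \<partial>\<mu>)"
  proof (rule integral_cong_AE)
    have meas: "(\<lambda>u. z - complex_of_real u) \<in> borel_measurable \<mu>"
      by measurable
    then show "(\<lambda>u. 1 / (z - complex_of_real u)) \<in> borel_measurable \<mu>"
      by measurable
    show "(\<lambda>u. \<Sum>n. ?f n u) \<in> borel_measurable \<mu>"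
      by measurable
    show "AE u in \<mu>. (\<Sum>n. ?f n u) = 1 / (z - of_real u)"
      using AE
    proof eventually_elim
      case (elim u)
      have lt: "norm (c * (of_real u - w)) < 1"
        using norm_c[OF elim] \<theta> by linarith
      have "(\<lambda>n. (c * (of_real u - w)) ^ n) sums (1 / (1 - c * (of_real u - w)))"
        using lt by (rule geometric_sums)
      from sums_mult[OF this, of c] have "(\<lambda>n. ?f n u) sums (c * (1 / (1 - c * (of_real u - w))))"
        by (simp only: power_mult_distrib)
      then have "(\<Sum>n. ?f n u) = c * (1 / (1 - c * (of_real u - w)))"
        by (rule sums_unique[symmetric])
      also have "\<dots> = 1 / ((z - w) * (1 - c * (of_real u - w)))"
        by (simp add: c_def)
      also have "(z - w) * (1 - c * (of_real u - w)) = (z - w) - ((z - w) * c) * (of_real u - w)"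
        by (simp only: right_diff_distrib mult.assoc mult_1_right)
      also have "\<dots> = z - of_real u"
        unfolding c by simp
      finally show ?case .
    qed
  qed
  moreover have "integral\<^sup>L \<mu> (?f n) = c * \<phi> (e ^ n)" for n
    unfolding \<phi>_e integral_mult_right_zero ..
  ultimately have "(\<lambda>n. c * \<phi> (e ^ n)) sums (\<integral>u. 1 / (z - of_real u) \<partial>\<mu>)"
    by (simp only:)
  moreover have "(\<lambda>n. c * \<phi> (e ^ n)) sums (c * \<phi> N)"
    unfolding N_def
    by (intro sums_mult bounded_linear.sums[OF bounded_linear] summable_sums complete_algebra_summable_geometric e)
  ultimately have "c * \<phi> N = (\<integral>u. 1 / (z - of_real u) \<partial>\<mu>)"
    using sums_unique2 by blast
  then have "\<phi> (c *\<^sub>C N) = (\<integral>u. 1 / (z - of_real u) \<partial>\<mu>)"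
    by (simp add: complex_linear)
  moreover have "(z *\<^sub>C 1 - x) * (c *\<^sub>C N) = 1" "(c *\<^sub>C N) * (z *\<^sub>C 1 - x) = 1"
    unfolding zx by (simp_all add: mult_scaleC_left mult_scaleC_right scaleC_scaleC c N)
  ultimately show thesis
    by (rule that[rotated 2])
qed

lemma resolvent:
  assumes "Im z \<noteq> 0"
  obtains r where "(z *\<^sub>C 1 - x) * r = 1" "r * (z *\<^sub>C 1 - x) = 1" "\<phi> r = (\<integral>u. 1 / (z - of_real u) \<partial>\<mu>)"
proof -
  \<comment> \<open>L bounds both the norm of x - Re z and |u - Re z| for almost all u. The centre w
    lies on the far side of the real axis, and 2 t |Im z| = L^2 makes |z - w|^2 = (Im z)^2 + L^2 +
    t^2, which exceeds the bound L^2 + t^2 for the squared norms of x - w and u - w.\<close>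
  define L where "L = norm (x - of_real (Re z) *\<^sub>C 1) + \<bar>R\<bar> + \<bar>Re z\<bar>"
  define t where "t = L\<^sup>2 / (2 * \<bar>Im z\<bar>)"
  define w where "w = Complex (Re z) (- sgn (Im z) * t)"
  define \<rho> where "\<rho> = sqrt (L\<^sup>2 + t\<^sup>2)"
  have t: "t \<ge> 0"
    by (simp add: t_def)
  have "Im (z - w) = sgn (Im z) * (\<bar>Im z\<bar> + t)"
    by (cases "Im z > 0") (simp_all add: w_def sgn_if abs_if algebra_simps)
  then have "cmod (z - w) = \<bar>sgn (Im z) * (\<bar>Im z\<bar> + t)\<bar>"
    by (simp add: cmod_def w_def)
  then have zw: "cmod (z - w) = \<bar>Im z\<bar> + t"
    using assms t by (simp add: abs_mult abs_sgn_eq)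
  have "(\<bar>Im z\<bar> + t)\<^sup>2 = (Im z)\<^sup>2 + L\<^sup>2 + t\<^sup>2"
    using assms by (simp add: power2_sum t_def)
  then have "\<rho>\<^sup>2 < (\<bar>Im z\<bar> + t)\<^sup>2"
    using assms by (simp add: \<rho>_def)
  then have \<rho>: "\<rho> < cmod (z - w)"
    unfolding zw by (rule power2_less_imp_less) (use t in auto)
  have Imw: "(Im w)\<^sup>2 = t\<^sup>2"
    using assms by (simp add: w_def power_mult_distrib sgn_if)
  have "(norm (x - w *\<^sub>C 1))\<^sup>2 \<le> (norm (x - of_real (Re z) *\<^sub>C 1))\<^sup>2 + t\<^sup>2"
    using norm_selfadjoint_shift[OF selfadjoint, of w] by (simp only: Imw) (simp add: w_def)
  also have "\<dots> \<le> L\<^sup>2 + t\<^sup>2"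
    by (intro add_right_mono power_mono) (auto simp: L_def)
  finally have "norm (x - w *\<^sub>C 1) \<le> \<rho>"
    unfolding \<rho>_def by (rule real_le_rsqrt)
  with \<rho> have 1: "norm (x - w *\<^sub>C 1) < cmod (z - w)"
    by linarith
  have 2: "AE u in \<mu>. cmod (of_real u - w) \<le> \<rho>"
    using AE_bounded
  proof eventually_elim
    case (elim u)
    have "(cmod (of_real u - w))\<^sup>2 = (u - Re z)\<^sup>2 + (Im w)\<^sup>2"
      by (simp add: cmod_power2 w_def)
    also have "(u - Re z)\<^sup>2 \<le> L\<^sup>2"
    proof -
      have "\<bar>u - Re z\<bar> \<le> L"
        using elim norm_ge_zero[of "x - of_real (Re z) *\<^sub>C 1"] unfolding L_def by linarith
      then show ?thesis
        by (metis abs_ge_zero power2_abs power_mono)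
    qed
    finally show ?case
      unfolding \<rho>_def by (intro real_le_rsqrt) (simp add: Imw)
  qed
  show thesis
    using resolvent_near[OF 1 \<rho> 2] that by blast
qed

end

section \<open>The entries of \<open>H\<close>\<close>

lemma mat2_nth [simp]:
  "mat2 a b c d $ 1 $ 1 = a" "mat2 a b c d $ 1 $ 2 = b" "mat2 a b c d $ 2 $ 1 = c" "mat2 a b c d $ 2 $ 2 = d"
  by (simp_all add: mat2_def)

lemma matrix_eq_2: "A = B \<longleftrightarrow> A $ 1 $ 1 = B $ 1 $ 1 \<and> A $ 1 $ 2 = B $ 1 $ 2 \<and> A $ 2 $ 1 = B $ 2 $ 1 \<and> A $ 2 $ 2 = B $ 2 $ 2"
  for A B :: "'a^2^2"
  by (auto simp: vec_eq_iff forall_2)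

lemma mat2_mult:
  fixes a :: "'a::semiring_1"
  shows "mat2 a b c d ** mat2 a' b' c' d' = mat2 (a * a' + b * c') (a * b' + b * d') (c * a' + d * c') (c * b' + d * d')"
  by (simp add: matrix_eq_2 matrix_matrix_mult_def sum_2)

lemma mat_1_eq_mat2: "mat 1 = mat2 1 0 0 (1::'a::semiring_1)"
  by (simp add: matrix_eq_2 mat_def)

text \<open>Associativity alone identifies the two-sided inverse, so entries may come from the
  noncommutative algebra.\<close>

lemma matrix_inv_unique_semiring:
  fixes A B :: "'a::semiring_1^'n^'n"
  assumes "A ** B = mat 1" "B ** A = mat 1"
  shows "matrix_inv A = B"
proof -
  have "A ** matrix_inv A = mat 1 \<and> matrix_inv A ** A = mat 1"
    unfolding matrix_inv_def by (rule someI[of _ B]) (use assms in auto)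
  then have "B ** (A ** matrix_inv A) = B"
    by simp
  then show ?thesis
    by (simp add: matrix_mul_assoc assms)
qed

context distribution_functional begin

text \<open>For B = B(\<lambda>, \<i> \<delta>), minus the determinant of B - X is (x - a)^2 + s^2
  with a = Re \<lambda> and s^2 = (Im \<lambda>)^2 + \<delta>^2, and r is its inverse. The point z =
  a + \<i> s is auxiliary and different from \<lambda>: it factors the quadratic into two
  resolvents, and partial fractions yield \<phi>(r) and \<phi>(x r).\<close>

lemma quadratic_resolvent:
  fixes a s :: real
  assumes s: "s > 0"
  defines "z \<equiv> Complex a s"
  obtains r where
    "(of_real ((cmod z)\<^sup>2) *\<^sub>C 1 - of_real (2 * a) *\<^sub>C x + x * x) * r = 1" "x * r = r * x"
    "r * (of_real ((cmod z)\<^sup>2) *\<^sub>C 1 - of_real (2 * a) *\<^sub>C x + x * x) = 1"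
    "\<phi> r = (\<integral>u. 1 / (of_real ((a - u)\<^sup>2 + s\<^sup>2)) \<partial>\<mu>)"
    "\<phi> (x * r) = (\<integral>u. of_real u / (of_real ((a - u)\<^sup>2 + s\<^sup>2)) \<partial>\<mu>)"
proof -
  have Im: "Im z \<noteq> 0" "Im (cnj z) \<noteq> 0"
    using s by (simp_all add: z_def)
  obtain r1 where r1: "(z *\<^sub>C 1 - x) * r1 = 1" "r1 * (z *\<^sub>C 1 - x) = 1" "\<phi> r1 = (\<integral>u. 1 / (z - of_real u) \<partial>\<mu>)"
    using resolvent[OF Im(1)] by blast
  obtain r2 where r2: "(cnj z *\<^sub>C 1 - x) * r2 = 1" "r2 * (cnj z *\<^sub>C 1 - x) = 1" "\<phi> r2 = (\<integral>u. 1 / (cnj z - of_real u) \<partial>\<mu>)"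
    using resolvent[OF Im(2)] by blast
  define r where "r = r1 * r2"
  let ?A = "z *\<^sub>C 1 - x" and ?B = "cnj z *\<^sub>C 1 - x"
  let ?P = "of_real ((cmod z)\<^sup>2) *\<^sub>C 1 - of_real (2 * a) *\<^sub>C x + x * x"
  have zz: "z * cnj z = of_real ((cmod z)\<^sup>2)" "z + cnj z = of_real (2 * a)" "z - cnj z = 2 * \<i> * of_real s"
    unfolding complex_norm_square[symmetric] by (simp_all add: z_def complex_eq_iff)
  have AB: "?A * ?B = ?P"
    unfolding zz(1)[symmetric] zz(2)[symmetric]
    by (simp add: left_diff_distrib right_diff_distrib scaleC_simps mult.commute[of "cnj z"])
  have BA: "?B * ?A = ?P"
    unfolding zz(1)[symmetric] zz(2)[symmetric]
    by (simp add: left_diff_distrib right_diff_distrib scaleC_simps mult.commute[of "cnj z"])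
  have Ar: "?A * r = r2"
    unfolding r_def mult.assoc[symmetric] r1 by simp
  have 1: "?P * r = 1"
    unfolding BA[symmetric] mult.assoc Ar by (rule r2)
  have rB: "r * ?B = r1"
    unfolding r_def mult.assoc r2 by simp
  have 2: "r * ?P = 1"
    unfolding BA[symmetric] mult.assoc[symmetric] rB by (rule r1)
  have comm: "x * ?P = ?P * x"
    by (simp add: left_diff_distrib right_diff_distrib distrib_left distrib_right scaleC_simps mult.assoc)
  have "x * r = (r * ?P) * x * r"
    unfolding 2 by simp
  also have "\<dots> = r * (?P * x) * r"
    by (simp only: mult.assoc)
  also have "\<dots> = r * x * (?P * r)"
    unfolding comm[symmetric] by (simp only: mult.assoc)
  finally have 3: "x * r = r * x"
    unfolding 1 by simp
  have bound: "cmod (1 / (w - of_real u)) \<le> 1 / s" if "\<bar>Im w\<bar> = s" for w u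
  proof -
    have "s \<le> cmod (w - of_real u)"
      using abs_Im_le_cmod[of "w - of_real u"] that by simp
    then show ?thesis
      using s by (simp add: norm_divide frac_le)
  qed
  have int: "integrable \<mu> (\<lambda>u. 1 / (w - of_real u))" if "\<bar>Im w\<bar> = s" for w
  proof (rule integrable_const_bound)
    show "AE u in \<mu>. norm (1 / (w - of_real u)) \<le> 1 / s"
      using bound[OF that] by simp
    have "(\<lambda>u. w - complex_of_real u) \<in> borel_measurable \<mu>"
      by measurable
    then show "(\<lambda>u. 1 / (w - complex_of_real u)) \<in> borel_measurable \<mu>"
      by measurable
  qed
  have Ims: "\<bar>Im z\<bar> = s" "\<bar>Im (cnj z)\<bar> = s"
    using s by (simp_all add: z_def)
  note int = int[OF Ims(1)] int[OF Ims(2)]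
  have nz: "z - of_real u \<noteq> 0" "cnj z - of_real u \<noteq> 0" for u
    using s by (auto simp: z_def complex_eq_iff)
  have den: "(z - of_real u) * (cnj z - of_real u) = of_real ((a - u)\<^sup>2 + s\<^sup>2)" for u
    by (simp add: z_def complex_eq_iff power2_eq_square algebra_simps)
  \<comment> \<open>The resolvent identity; the integrands below satisfy the same identity
    pointwise, and the factor 2 \<i> s cancels.\<close>
  have "r2 - r1 = (2 * \<i> * of_real s) *\<^sub>C r"
  proof -
    have "r2 - r1 = ?A * r - r * ?B"
      by (simp only: Ar rB)
    also have "\<dots> = (z - cnj z) *\<^sub>C r"
      using 3 by (simp add: left_diff_distrib right_diff_distrib scaleC_simps)
    finally show ?thesis
      unfolding zz .
  qed
  then have "\<phi> r2 - \<phi> r1 = 2 * \<i> * of_real s * \<phi> r"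
    using \<phi>_diff[of r2 r1] complex_linear by simp
  then have "2 * \<i> * of_real s * \<phi> r = (\<integral>u. 1 / (cnj z - of_real u) - 1 / (z - of_real u) \<partial>\<mu>)"
    by (simp add: r1(3) r2(3) Bochner_Integration.integral_diff[OF int(2,1)])
  also have "\<dots> = (\<integral>u. (2 * \<i> * of_real s) * (1 / of_real ((a - u)\<^sup>2 + s\<^sup>2)) \<partial>\<mu>)"
  proof (rule Bochner_Integration.integral_cong[OF refl])
    fix u
    have "1 / (cnj z - of_real u) - 1 / (z - of_real u) = (z - cnj z) / ((z - of_real u) * (cnj z - of_real u))"
      using nz by (simp add: field_simps)
    then show "1 / (cnj z - of_real u) - 1 / (z - of_real u) = (2 * \<i> * of_real s) * (1 / of_real ((a - u)\<^sup>2 + s\<^sup>2))"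
      unfolding den zz by simp
  qed
  also have "\<dots> = (2 * \<i> * of_real s) * (\<integral>u. 1 / of_real ((a - u)\<^sup>2 + s\<^sup>2) \<partial>\<mu>)"
    by (rule integral_mult_right_zero)
  finally have 4: "\<phi> r = (\<integral>u. 1 / of_real ((a - u)\<^sup>2 + s\<^sup>2) \<partial>\<mu>)"
    using s by simp
  have int4: "integrable \<mu> (\<lambda>u. 1 / complex_of_real ((a - u)\<^sup>2 + s\<^sup>2))"
  proof -
    have "integrable \<mu> (\<lambda>u. (1 / (cnj z - of_real u) - 1 / (z - of_real u)) / (2 * \<i> * of_real s))"
      using int by (intro integrable_divide Bochner_Integration.integrable_diff)
    also have "(\<lambda>u. (1 / (cnj z - of_real u) - 1 / (z - of_real u)) / (2 * \<i> * of_real s)) = (\<lambda>u. 1 / complex_of_real ((a - u)\<^sup>2 + s\<^sup>2))"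
    proof
      fix u
      have "1 / (cnj z - of_real u) - 1 / (z - of_real u) = (z - cnj z) / ((z - of_real u) * (cnj z - of_real u))"
        using nz by (simp add: field_simps)
      then show "(1 / (cnj z - of_real u) - 1 / (z - of_real u)) / (2 * \<i> * of_real s) = 1 / complex_of_real ((a - u)\<^sup>2 + s\<^sup>2)"
        unfolding den zz using s by simp
    qed
    finally show ?thesis .
  qed
  have "x * r = z *\<^sub>C r - r2"
    using Ar by (simp add: left_diff_distrib scaleC_simps algebra_simps)
  then have "\<phi> (x * r) = (\<integral>u. z * (1 / of_real ((a - u)\<^sup>2 + s\<^sup>2)) - 1 / (cnj z - of_real u) \<partial>\<mu>)"
    by (simp only: \<phi>_diff complex_linear 4 r2(3) integral_mult_right_zero
        Bochner_Integration.integral_diff[OF integrable_mult_right[OF int4] int(2)])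
  also have "\<dots> = (\<integral>u. of_real u / of_real ((a - u)\<^sup>2 + s\<^sup>2) \<partial>\<mu>)"
  proof (rule Bochner_Integration.integral_cong[OF refl])
    fix u
    have "z * (1 / (v * v')) - 1 / v' = (z - v) / (v * v')" if "v \<noteq> 0" "v' \<noteq> 0" for v v'
      using that by (simp add: field_simps)
    from this[OF nz, of u u] have "z * (1 / ((z - of_real u) * (cnj z - of_real u))) - 1 / (cnj z - of_real u)
      = of_real u / ((z - of_real u) * (cnj z - of_real u))"
      by simp
    then show "z * (1 / of_real ((a - u)\<^sup>2 + s\<^sup>2)) - 1 / (cnj z - of_real u) = of_real u / of_real ((a - u)\<^sup>2 + s\<^sup>2)"
      unfolding den .
  qed
  finally have 5: "\<phi> (x * r) = (\<integral>u. of_real u / of_real ((a - u)\<^sup>2 + s\<^sup>2) \<partial>\<mu>)" .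
  show thesis
    using that[OF 1 3 2 4 5] .
qed

lemma G_X_Bmat:
  assumes d: "d > 0"
  shows "G_X \<phi> x (Bmat z (\<i> * of_real d)) =
    (let T = fst (V (z, d)); s = - \<i> * of_real (d * S (z, d)) in mat2 s T (cnj T) s)"
proof -
  define a b s where "a = Re z" and "b = Im z" and "s = sqrt (b\<^sup>2 + d\<^sup>2)"
  have s: "s > 0" "s\<^sup>2 = b\<^sup>2 + d\<^sup>2"
    using d by (simp_all add: s_def add_nonneg_pos)
  let ?n = "(cmod (Complex a s))\<^sup>2"
  let ?P = "of_real ?n *\<^sub>C 1 - of_real (2 * a) *\<^sub>C x + x * x"
  let ?w = "\<lambda>u. (a - u)\<^sup>2 + s\<^sup>2"
  obtain r where r: "?P * r = 1" "x * r = r * x" "r * ?P = 1"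
    and \<phi>r: "\<phi> r = (\<integral>u. 1 / (of_real (?w u)) \<partial>\<mu>)"
    and \<phi>xr: "\<phi> (x * r) = (\<integral>u. of_real u / (of_real (?w u)) \<partial>\<mu>)"
    by (rule quadratic_resolvent[OF s(1), of a])
  let ?\<zeta> = "\<i> * complex_of_real d"
  let ?X = "z *\<^sub>C 1 - x" and ?Y = "cnj z *\<^sub>C 1 - x"
  have n: "of_real ?n = z * cnj z + of_real (d\<^sup>2)" "of_real (2 * a) = z + cnj z"
    unfolding cmod_power2 complex.sel s(2)
    by (simp_all add: complex_eq_iff a_def b_def power2_eq_square)
  have P: "of_real (d\<^sup>2) *\<^sub>C 1 + ?X * ?Y = ?P" "of_real (d\<^sup>2) *\<^sub>C 1 + ?Y * ?X = ?P"
    unfolding n by (simp_all add: left_diff_distrib right_diff_distrib scaleC_simps mult.commute[of "cnj z"])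
  have \<zeta>: "?\<zeta> * - ?\<zeta> = of_real (d\<^sup>2)" "- ?\<zeta> * ?\<zeta> = of_real (d\<^sup>2)"
    by (simp_all add: complex_eq_iff power2_eq_square)
  have rX: "r * ?X = ?X * r" "r * ?Y = ?Y * r"
    using r(2) by (simp_all add: left_diff_distrib right_diff_distrib scaleC_simps)
  let ?A = "mat2 (?\<zeta> *\<^sub>C 1) ?X ?Y (?\<zeta> *\<^sub>C 1)"
  \<comment> \<open>The adjugate divided by the determinant: all entries commute, and the
    determinant is \<open>- ?P\<close>.\<close>
  let ?I = "mat2 ((- ?\<zeta>) *\<^sub>C r) (?X * r) (?Y * r) ((- ?\<zeta>) *\<^sub>C r)"
  have diag: "(?\<zeta> *\<^sub>C 1) * ((- ?\<zeta>) *\<^sub>C r) + ?X * (?Y * r) = 1" "?Y * (?X * r) + (?\<zeta> *\<^sub>C 1) * ((- ?\<zeta>) *\<^sub>C r) = 1"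
  proof -
    have "(?\<zeta> *\<^sub>C 1) * ((- ?\<zeta>) *\<^sub>C r) = (of_real (d\<^sup>2) *\<^sub>C 1) * r"
      unfolding mult_scaleC_left mult_scaleC_right scaleC_scaleC \<zeta> by simp
    then show "(?\<zeta> *\<^sub>C 1) * ((- ?\<zeta>) *\<^sub>C r) + ?X * (?Y * r) = 1" "?Y * (?X * r) + (?\<zeta> *\<^sub>C 1) * ((- ?\<zeta>) *\<^sub>C r) = 1"
      unfolding mult.assoc[symmetric, of ?X] mult.assoc[symmetric, of ?Y]
      by (simp_all only: distrib_right[symmetric] P r add.commute[of "?Y * ?X"])
  qed
  have AI: "?A ** ?I = mat 1"
    unfolding mat2_mult mat_1_eq_mat2 using diag
    by (simp add: scaleC_simps matrix_eq_2)
  have diag': "((- ?\<zeta>) *\<^sub>C r) * (?\<zeta> *\<^sub>C 1) + ?X * r * ?Y = 1" "?Y * r * ?X + ((- ?\<zeta>) *\<^sub>C r) * (?\<zeta> *\<^sub>C 1) = 1"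
  proof -
    have "((- ?\<zeta>) *\<^sub>C r) * (?\<zeta> *\<^sub>C 1) = (?\<zeta> *\<^sub>C 1) * ((- ?\<zeta>) *\<^sub>C r)"
      unfolding mult_scaleC_left mult_scaleC_right scaleC_scaleC by (simp add: mult.commute)
    moreover have "?X * r * ?Y = ?X * (?Y * r)" "?Y * r * ?X = ?Y * (?X * r)"
      unfolding mult.assoc rX by (rule refl)+
    ultimately show "((- ?\<zeta>) *\<^sub>C r) * (?\<zeta> *\<^sub>C 1) + ?X * r * ?Y = 1" "?Y * r * ?X + ((- ?\<zeta>) *\<^sub>C r) * (?\<zeta> *\<^sub>C 1) = 1"
      using diag by (simp_all only:)
  qed
  have off: "((- ?\<zeta>) *\<^sub>C r) * ?X + ?X * r * (?\<zeta> *\<^sub>C 1) = 0" "?Y * r * (?\<zeta> *\<^sub>C 1) + ((- ?\<zeta>) *\<^sub>C r) * ?Y = 0"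
    unfolding mult_scaleC_left mult_scaleC_right rX by (simp_all add: scaleC_minus_left)
  have IA: "?I ** ?A = mat 1"
    unfolding mat2_mult mat_1_eq_mat2 diag' off by (simp add: diag' off)
  have "map_matrix (\<lambda>c. c *\<^sub>C 1) (Bmat z ?\<zeta>) - mat2 0 x x 0 = ?A"
    by (simp add: matrix_eq_2 Bmat_def)
  then have G: "G_X \<phi> x (Bmat z ?\<zeta>) = map_matrix \<phi> ?I"
    unfolding G_X_def using matrix_inv_unique_semiring[OF AI IA] by simp
  have reg: "regular (z, d)"
    using d by (intro regular_snd) auto
  have n2: "(norm ((z, d) - axis_point u))\<^sup>2 = ?w u" for u
    unfolding norm_axis_diff_Re_Im by (simp add: a_def b_def s(2))
  have S: "S (z, d) = (\<integral>u. 1 / ?w u \<partial>\<mu>)"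
    unfolding S_def n2 ..
  have \<phi>r_S: "\<phi> r = of_real (S (z, d))"
    unfolding \<phi>r S integral_complex_of_real[symmetric] by simp
  have int_S: "integrable \<mu> (\<lambda>u. 1 / ?w u)"
    using reg unfolding regular_def n2 by blast
  have int_u: "integrable \<mu> (\<lambda>u. u / ?w u)"
  proof -
    have "integrable \<mu> (\<lambda>u. a * (1 / ?w u) - (a - u) / ?w u)"
      using integrable_first_moment[OF reg] unfolding n2 fst_conv a_def[symmetric]
      by (intro Bochner_Integration.integrable_diff integrable_mult_right int_S)
    then show ?thesis
      by (simp add: diff_divide_distrib)
  qed
  have \<phi>xr_real: "\<phi> (x * r) = of_real (\<integral>u. u / ?w u \<partial>\<mu>)"
    unfolding \<phi>xr integral_complex_of_real[symmetric] by simp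
  have T: "fst (V (z, d)) = z * of_real (S (z, d)) - of_real (\<integral>u. u / ?w u \<partial>\<mu>)"
  proof (rule complex_eqI)
    have "Re (fst (V (z, d))) = (\<integral>u. a * (1 / ?w u) - u / ?w u \<partial>\<mu>)"
      unfolding Re_V[OF reg] n2 fst_conv a_def[symmetric] by (simp add: diff_divide_distrib)
    also have "\<dots> = a * S (z, d) - (\<integral>u. u / ?w u \<partial>\<mu>)"
      unfolding Bochner_Integration.integral_diff[OF integrable_mult_right[OF int_S] int_u] integral_mult_right_zero S ..
    finally show "Re (fst (V (z, d))) = Re (z * of_real (S (z, d)) - of_real (\<integral>u. u / ?w u \<partial>\<mu>))"
      by (simp add: a_def)
    show "Im (fst (V (z, d))) = Im (z * of_real (S (z, d)) - of_real (\<integral>u. u / ?w u \<partial>\<mu>))"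
      by (simp add: Im_V[OF reg])
  qed
  have X: "\<phi> ((w *\<^sub>C 1 - x) * r) = w * \<phi> r - \<phi> (x * r)" for w
    by (simp add: left_diff_distrib mult_scaleC_left \<phi>_diff complex_linear)
  show ?thesis
    unfolding G Let_def
    by (simp add: matrix_eq_2 complex_linear X \<phi>r_S \<phi>xr_real T)
qed

lemma H_entries:
  assumes d: "d > 0"
  shows "H11 \<phi> x p z (\<i> * of_real d) = \<i> * of_real (d - p * (d * S (z, d)) / (norm (W (z, d)))\<^sup>2)"
    and "H12 \<phi> x p z (\<i> * of_real d) = fst (subord p (z, d))"
proof -
  define T s n where "T = fst (V (z, d))" and "s = d * S (z, d)" and "n = (norm (W (z, d)))\<^sup>2"
  have reg: "regular (z, d)"
    using d by (intro regular_snd) auto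
  have n: "n = (cmod (T - \<i>))\<^sup>2 + s\<^sup>2"
    using snd_V[OF reg] by (cases "V (z, d)") (simp add: n_def W_def T_def s_def norm_Pair)
  have "n > 0"
    using d S_pos[OF reg] unfolding n s_def by (intro add_nonneg_pos) auto
  have n': "complex_of_real n = (T - \<i>) * (cnj T + \<i>) + of_real s * of_real s"
    using complex_norm_square[of "T - \<i>"] by (simp add: n power2_eq_square)
  define c where "c = inverse (complex_of_real n)"
  have c: "c * of_real n = 1"
    using \<open>n > 0\<close> by (simp add: c_def)
  let ?M = "mat2 (\<i> * of_real s) (\<i> - T) (- \<i> - cnj T) (\<i> * of_real s)"
  \<comment> \<open>Again the adjugate over the determinant, which is -n for
    \<open>?M\<close>.\<close>
  let ?N = "mat2 (- \<i> * of_real s * c) ((\<i> - T) * c) ((- \<i> - cnj T) * c) (- \<i> * of_real s * c)"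
  have "mat2 0 \<i> (- \<i>) 0 - G_X \<phi> x (Bmat z (\<i> * of_real d)) = ?M"
    unfolding G_X_Bmat[OF d] Let_def by (simp add: matrix_eq_2 T_def s_def)
  moreover have "matrix_inv ?M = ?N"
  proof (rule matrix_inv_unique_semiring)
    have 1: "\<i> * of_real s * (- \<i> * of_real s * c) + (\<i> - T) * ((- \<i> - cnj T) * c) = 1"
      "(- \<i> - cnj T) * ((\<i> - T) * c) + \<i> * of_real s * (- \<i> * of_real s * c) = 1"
      unfolding c[symmetric] n' by (simp_all add: algebra_simps)
    have 2: "- \<i> * of_real s * c * (\<i> * of_real s) + (\<i> - T) * c * (- \<i> - cnj T) = 1"
      "(- \<i> - cnj T) * c * (\<i> - T) + - \<i> * of_real s * c * (\<i> * of_real s) = 1"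
      unfolding c[symmetric] n' by (simp_all add: algebra_simps)
    show "?M ** ?N = mat 1"
      unfolding mat2_mult mat_1_eq_mat2 1 by (simp add: 1 algebra_simps)
    show "?N ** ?M = mat 1"
      unfolding mat2_mult mat_1_eq_mat2 2 by (simp add: 2 algebra_simps)
  qed
  ultimately have H: "H \<phi> x p (Bmat z (\<i> * of_real d)) = Bmat z (\<i> * of_real d) + p *\<^sub>R ?N"
    by (simp add: H_def)
  have cr: "c = of_real (1 / n)"
    by (simp add: c_def divide_inverse)
  show "H11 \<phi> x p z (\<i> * of_real d) = \<i> * of_real (d - p * (d * S (z, d)) / (norm (W (z, d)))\<^sup>2)"
    unfolding H11_def H n_def[symmetric] s_def[symmetric]
    by (simp add: Bmat_def cr scaleR_conv_of_real[where 'a=complex] algebra_simps)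
  have "H12 \<phi> x p z (\<i> * of_real d) = z + of_real p * ((\<i> - T) * c)"
    unfolding H12_def H by (simp add: Bmat_def scaleR_conv_of_real[where 'a=complex])
  also have "\<dots> = fst (subord p (z, d))"
    by (simp add: subord_def inversion_def W_def T_def[symmetric] n_def[unfolded W_def, symmetric] c_def
        scaleR_conv_of_real[where 'a=complex] algebra_simps)
  finally show "H12 \<phi> x p z (\<i> * of_real d) = fst (subord p (z, d))" .
qed

section \<open>Identification of \<open>domD\<close>, \<open>delta0\<close> and
  \<open>h\<close>\<close>

lemma norm_W_pos:
  assumes "d > 0"
  shows "(norm (W (z, d)))\<^sup>2 > 0"
proof -
  have reg: "regular (z, d)"
    using assms by (intro regular_snd) auto
  then have "snd (W (z, d)) \<noteq> 0"
    using assms S_pos[OF reg] by (simp add: W_def snd_V)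
  then show ?thesis
    by auto
qed

lemma Im_H11:
  assumes "d > 0"
  shows "Im (H11 \<phi> x p z (\<i> * of_real d)) / d = 1 - p / level (z, d)"
  using assms by (simp add: H_entries(1) level_def diff_divide_distrib)

lemma level_pos:
  assumes "d > 0"
  shows "level (z, d) > 0"
  using norm_W_pos[OF assms] S_pos[OF regular_snd[of "(z, d)"]] assms by (simp add: level_def)

text \<open>Membership in \<open>domD\<close> includes the existence of the limit. The quotient is
  monotone in d, so it tends to its infimum over d > 0 in the extended reals, and one negative value
  makes this infimum negative.\<close>

lemma domD_eq_base:
  assumes p: "p > 0"
  shows "domD \<phi> x p = base p"
proof (intro set_eqI iffI)
  fix z
  let ?f = "\<lambda>d. ereal (Im (H11 \<phi> x p z (\<i> * of_real d)) / d)"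
  have f_less: "?f d < 0 \<longleftrightarrow> level (z, d) < p" if "d > 0" for d
    using that level_pos[OF that, of z] by (simp add: Im_H11)
  {
    assume "z \<in> domD \<phi> x p"
    then obtain l where "l < 0" "(?f \<longlongrightarrow> l) (at_right 0)"
      by (auto simp: domD_def)
    then have "\<forall>\<^sub>F d in at_right 0. ?f d < 0"
      by (rule order_tendstoD(2)[rotated])
    with eventually_at_right_less[of "0::real"] have "\<forall>\<^sub>F d in at_right 0. d > 0 \<and> level (z, d) < p"
      by eventually_elim (use f_less in auto)
    then obtain d where "d > 0 \<and> level (z, d) < p"
      using eventually_happens[of _ "at_right (0::real)"] by auto
    then show "z \<in> base p"
      by (auto simp: base_def)
  next
    assume "z \<in> base p"
    then obtain d where d: "d > 0" "level (z, d) < p"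
      by (auto simp: base_def)
    have mono: "?f e \<le> ?f e'" if "0 < e" "e \<le> e'" for e e'
    proof (cases "e = e'")
      case False
      with that have "level (z, e) < level (z, e')"
        by (intro level_strict_mono) auto
      then have "p / level (z, e') \<le> p / level (z, e)"
        using p that level_pos[of e z] by (intro divide_left_mono) (auto intro!: mult_pos_pos level_pos)
      then show ?thesis
        using that by (simp add: Im_H11)
    qed auto
    define l where "l = (INF e\<in>{0<..}. ?f e)"
    have "l \<le> ?f d"
      unfolding l_def using d by (intro INF_lower) auto
    then have "l < 0"
      using f_less[OF d(1)] d(2) by (meson le_less_trans)
    moreover have "(?f \<longlongrightarrow> l) (at_right 0)"
    proof (rule order_tendstoI)
      fix a assume "a < l"
      have "a < ?f e" if "e > 0" for e
        using \<open>a < l\<close> INF_lower[of e "{0<..}" ?f] that unfolding l_def by (auto intro: less_le_trans)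
      then show "\<forall>\<^sub>F e in at_right 0. a < ?f e"
        using eventually_at_right_less[of "0::real"] by (auto elim: eventually_mono)
    next
      fix a assume "l < a"
      then obtain e where e: "e > 0" "?f e < a"
        unfolding l_def INF_less_iff by auto
      have "?f e' < a" if "0 < e'" "e' < e" for e'
        using mono[of e' e] that e by (meson le_less_trans less_imp_le)
      then show "\<forall>\<^sub>F e in at_right 0. ?f e < a"
        using e(1) by (auto simp: eventually_at_right_field)
    qed
    ultimately show "z \<in> domD \<phi> x p"
      by (auto simp: domD_def)
  }
qed

lemma delta0_eq_height:
  assumes "p > 0" "z \<in> base p"
  shows "delta0 \<phi> x p z = height p z"
proof -
  have "0 < d \<and> H11 \<phi> x p z (\<i> * of_real d) = 0 \<longleftrightarrow> d > 0 \<and> level (z, d) = p" for d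
  proof (cases "d > 0")
    case True
    \<comment> \<open>At these arguments H11 is purely imaginary, so it vanishes together with its
      imaginary part.\<close>
    have "\<i> * complex_of_real t = 0 \<longleftrightarrow> Im (\<i> * complex_of_real t) / d = 0" for t
      using True by simp
    then have "H11 \<phi> x p z (\<i> * of_real d) = 0 \<longleftrightarrow> Im (H11 \<phi> x p z (\<i> * of_real d)) / d = 0"
      unfolding H_entries(1)[OF True] .
    also have "\<dots> \<longleftrightarrow> level (z, d) = p"
      using level_pos[OF True, of z] by (auto simp: Im_H11[OF True])
    finally show ?thesis by simp
  qed simp
  then show ?thesis
    using assms by (simp add: delta0_def height_def)
qed

lemma fst_V_axis: "fst (V (z, 0)) = cnj (Cauchy_transform \<mu> z)" if "regular (z, 0)"
proof -
  have eq: "fst (inversion ((z, 0::real) - axis_point u)) = cnj (1 / (z - of_real u))" for u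
  proof (cases "z = of_real u")
    case False
    have "fst (inversion ((z, 0::real) - axis_point u)) = (z - of_real u) / of_real ((cmod (z - of_real u))\<^sup>2)"
      unfolding inversion_def norm_axis_diff by (simp add: scaleR_conv_of_real divide_inverse mult.commute)
    moreover have "w / (w * cnj w) = cnj (1 / w)" if "w \<noteq> 0" for w
      using that by simp
    moreover have "z - of_real u \<noteq> 0"
      using False by simp
    ultimately show ?thesis
      unfolding complex_norm_square by metis
  qed (simp add: inversion_def)
  have "fst (V (z, 0)) = (\<integral>u. cnj (1 / (z - of_real u)) \<partial>\<mu>)"
    unfolding V_def integral_bounded_linear[OF bounded_linear_fst integrable_inversion[OF that], symmetric] eq ..
  then show ?thesis
    unfolding Cauchy_transform_def Bochner_Integration.integral_cnj .
qed

text \<open>On \<open>base\<close> the value \<open>delta0\<close> is the height. An atom off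
  \<open>base\<close> destroys \<open>regular\<close> at height 0, so both functions return z. Every
  other z has atom mass 0 < p and is covered by \<open>good_outside_base\<close>.\<close>

lemma h_eq_hmap:
  assumes p: "p > 0"
  shows "h \<phi> x p \<mu> = hmap p"
proof
  fix z
  have atom: "z \<in> complex_of_real ` atoms \<mu> \<longleftrightarrow> atom_mass z > 0"
  proof
    assume "z \<in> complex_of_real ` atoms \<mu>"
    then show "atom_mass z > 0"
      by (auto simp: atoms_def atom_mass_def)
  next
    assume *: "atom_mass z > 0"
    then have "{u. complex_of_real u = z} \<noteq> {}"
      unfolding atom_mass_def by (metis less_irrefl measure_empty)
    then obtain u where "z = of_real u"
      by auto
    with * show "z \<in> complex_of_real ` atoms \<mu>"
      by (simp add: atoms_def atom_mass_def)
  qed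
  have "atom_mass z > 0 \<or> atom_mass z = 0"
    using measure_nonneg[of \<mu> "{u. complex_of_real u = z}"] unfolding atom_mass_def by linarith
  then consider "z \<in> base p" | "z \<notin> base p" "atom_mass z > 0" | "z \<notin> base p" "atom_mass z = 0"
    by blast
  then show "h \<phi> x p \<mu> z = hmap p z"
  proof cases
    case 1
    then show ?thesis
      using good_base(1)[OF p 1] H_entries(2)[OF height_base(1)[OF 1]]
      by (simp add: h_def domD_eq_base[OF p] delta0_eq_height[OF p] hmap_def)
  next
    case 2
    have "\<not> regular (z, 0)"
    proof
      assume "regular (z, 0)"
      then have "AE u in \<mu>. u \<notin> {u. complex_of_real u = z}"
        by (auto simp: regular_def elim: eventually_mono)
      then have "atom_mass z = 0"
        unfolding atom_mass_def using sets_atom by (subst prob_eq_0) auto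
      with 2 show False by simp
    qed
    then have "hmap p z = z"
      using 2 by (simp add: hmap_def height_def good_def)
    then show ?thesis
      using 2 atom by (simp add: h_def domD_eq_base[OF p])
  next
    case 3
    have good: "good p (z, 0)"
      using 3 p by (intro good_outside_base) auto
    then have reg: "regular (z, 0)"
      by (simp add: good_def)
    let ?C = "Cauchy_transform \<mu> z"
    \<comment> \<open>Inversion in the plane is the conjugate of the reciprocal: it makes
      \<open>V\<close> the conjugate of the Cauchy transform, subtracting \<i> conjugates to adding
      \<i>, and the second inversion returns 1 / (\<i> + \<open>?C\<close>).\<close>
    have W: "W (z, 0) = (cnj (?C + \<i>), 0)"
      unfolding W_def using snd_V[OF reg] fst_V_axis[OF reg] by (simp add: prod_eq_iff)
    have ne: "?C + \<i> \<noteq> 0"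
    proof
      assume "?C + \<i> = 0"
      then have "W (z, 0) = 0"
        unfolding W by (simp only: complex_cnj_zero zero_prod_def)
      then show False
        using good by (simp add: good_def)
    qed
    have "(norm (W (z, 0)))\<^sup>2 = (cmod (?C + \<i>))\<^sup>2"
      unfolding W norm_Pair complex_mod_cnj by simp
    then have "complex_of_real ((norm (W (z, 0)))\<^sup>2) = (?C + \<i>) * cnj (?C + \<i>)"
      by (simp only: complex_norm_square)
    then have "fst (inversion (W (z, 0))) = cnj (?C + \<i>) / ((?C + \<i>) * cnj (?C + \<i>))"
      by (simp add: inversion_def W scaleR_conv_of_real divide_inverse mult.commute)
    also have "\<dots> = 1 / (?C + \<i>)"
    proof -
      have "cnj w / (w * cnj w) = 1 / w" if "w \<noteq> 0" for w
        using that by simp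
      from this[OF ne] show ?thesis .
    qed
    finally have inv: "fst (inversion (W (z, 0))) = 1 / (\<i> + ?C)"
      by (simp only: add.commute)
    have "hmap p z = z - of_real p * fst (inversion (W (z, 0)))"
      using good 3 by (simp add: hmap_def height_def subord_def scaleR_conv_of_real)
    then show ?thesis
      using 3 atom unfolding inv by (simp add: h_def domD_eq_base[OF p])
  qed
qed

end

theorem theorem5p9:
  fixes \<phi> :: "'a::cstar_algebra \<Rightarrow> complex" and x y :: 'a
    and p :: real and \<mu> :: "real measure"
  assumes "wstar_probability_space \<phi>" and "faithful_state \<phi>" and "tracial \<phi>"
    and "selfadjoint x" and "selfadjoint y" and "freely_independent \<phi> x y"
    and "0 < p" and "free_Poisson \<phi> y p"
    and "is_distribution \<phi> x \<mu>"
    and "\<not> point_mass \<mu>"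
    and "complex_of_real ` measure_support (continuous_part \<mu>) \<subseteq> domD \<phi> x p"
    and "complex_of_real ` atoms \<mu> \<inter> (closure (domD \<phi> x p) - domD \<phi> x p) = {}"
  shows "\<exists>g. homeomorphism UNIV UNIV (h \<phi> x p \<mu>) g"
proof -
  \<comment> \<open>Being in a predual makes \<phi> bounded and complex linear, as required for
    applying it termwise to Neumann series.\<close>
  obtain P f where "predual P" "f \<in> P" and \<phi>: "\<phi> = blinfun_apply f"
    using assms(1) by (auto simp: wstar_probability_space_def)
  then have linear: "\<phi> (c *\<^sub>C a) = c * \<phi> a" for c a
    by (simp add: predual_def)
  have bl: "bounded_linear \<phi>"
    unfolding \<phi> by (rule blinfun.bounded_linear_right)
  from assms(9) obtain K where "prob_space \<mu>" and sets: "sets \<mu> = sets borel"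
    and K: "compact K" "emeasure \<mu> (- K) = 0"
    and moments: "\<And>n. \<phi> (x ^ n) = of_real (\<integral>u. u ^ n \<partial>\<mu>)"
    by (auto simp: is_distribution_def)
  interpret prob_space \<mu> by fact
  obtain R where R: "\<And>u. u \<in> K \<Longrightarrow> \<bar>u\<bar> \<le> R"
    using compact_imp_bounded[OF K(1)] by (auto simp: bounded_iff)
  have AE: "AE u in \<mu>. \<bar>u\<bar> \<le> R"
    using K R by (intro AE_I[of _ _ "- K"]) (auto simp: sets compact_imp_closed borel_closed)
  interpret distribution_functional \<mu> R \<phi> x
    by (intro distribution_functional.intro distribution_functional_axioms.intro bounded_distribution.intro
        bounded_distribution_axioms.intro prob_space_axioms) (fact sets AE bl linear moments assms(4))+
  show ?thesis
    unfolding h_eq_hmap[OF assms(7)] using assms(10,7) by (rule hmap_homeomorphism)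
qed

end
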